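(* Let $\pi$ be a regular pattern with rotation number $\rho\neq\frac13$, the branches of the triod $T$ being numbered canonically for $\pi$. Then $\pi$ is a triod twist if and only if $\pi$ is green and has a strictly increasing code function.
   Context: The triod is $T=\{z\in\mathbb{C}: z^3\in[0,1]\}$, with central (branching) point $a=0$; the branches of $T$ are the three components of $T\setminus\{a\}$. For $x,y$ on the same branch, write $x>y$ if $x$ is farther from $a$ than $y$. Let $\mathcal{U}$ be the set of continuous maps $f:T\to T$ for which $a$ is the unique fixed point. A cycle is a periodic orbit $P\neq\{a\}$ of some $f\in\mathcal{U}$; $[P]$ is its convex hull in $T$. Cycles $P$ of $f$ and $Q$ of $g$ are equivalent if there is a homeomorphism $h:[P]\to[Q]$ with $h(P)=Q$ and $h\circ f=g\circ h$ on $P$, which fixes branches (points of each branch are sent into the same branch). The equivalence class of $P$ is its pattern, and $P$ exhibits that pattern. A pattern $A$ forces a pattern $B$ if every $f\in\mathcal{U}$ with a cycle of pattern $A$ also has a cycle of pattern $B$. A cycle and its pattern are primitive if each point of the cycle lies on a different branch. A pattern is regular if it does not force a primitive pattern of period $2$; a cycle is regular if its pattern is. Number the branches $b_0,b_1,b_2$ (indices mod $3$). For $u\in b_i$, $v\in b_j$ put $d(u,v)=\frac k3$, where $k\in\{0,1,2\}$ and $j\equiv i+k \pmod 3$. For a cycle $P$ of $f$, a point $x\in P$ is green, black or red according as $d(x,f(x))=0,\frac13,\frac23$. If $P$ has period $n$, its rotation pair is $\left(\sum_{i=0}^{n-1}d(f^i(x),f^{i+1}(x)),\,n\right)$ for $x\in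 P$ (the first entry is an integer), and its rotation number is the quotient of the first entry by the second; these depend only on the pattern. The numbering is canonical for a regular cycle (or its pattern) if, for each $i$, the point of the cycle on $b_i$ closest to $a$ is black; every regular cycle admits a canonical numbering. All rotation numbers are computed with the fixed numbering. A triod twist is a regular pattern that does not force another pattern with the same rotation number. A regular cycle $P$ of $f$ is green if for all $x,y\in P$ with $x>y$ such that $f(x),f(y)$ lie on the same branch, $f(x)>f(y)$; a pattern is green if the cycles exhibiting it are green. For a cycle $P$ of $f$ with rotation number $\rho\ne\frac13$, the code function (also called phase function) $\psi:P\to\mathbb{R}$ is defined by choosing $x_0\in P$, setting $\psi(x_0)=0$ and $\psi(f^k(x_0))=\psi(x_0)+k\rho-[t_k]$ for $k\in\mathbb{N}$, where $t_k=\sum_{j=0}^{k-1}d(f^j(x_0),f^{j+1}(x_0))$ and $[\cdot]$ is the integer part (floor). The code function is non-decreasing if: for $\rho<\frac13$, $\psi(x)\le\psi(y)$ whenever $x>y$; for $\rho>\frac13$, $\psi(x)\ge\psi(y)$ whenever $x>y$ ($x,y\in P$). It is strictly increasing if it is non-decreasing and no two consecutive points of $P$ on the same branch have the same value of $\psi$. A pattern has a strictly increasing code function if the cycles exhibiting it do. *)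

theory Defs
  imports "HOL-Analysis.Analysis"
begin

section \<open>The triod, its branches and the class of maps\<close>

definition triod :: "complex set" where
  "triod = {z. z ^ 3 \<in> complex_of_real ` {0..1}}"

definition branches :: "complex set set" where
  "branches = components (triod - {0})"

definition same_branch :: "complex \<Rightarrow> complex \<Rightarrow> bool" where
  "same_branch x y \<longleftrightarrow> (\<exists>B\<in>branches. x \<in> B \<and> y \<in> B)"

text \<open>The order \<open>x > y\<close> of the branches. Each branch is a straight segment issuing from
  \<open>0\<close>, so that ``farther from the branching point'' can be read off the Euclidean distance.\<close>

definition farther :: "complex \<Rightarrow> complex \<Rightarrow> bool" where
  "farther x y \<longleftrightarrow> same_branch x y \<and> dist 0 x > dist 0 y"

text \<open>Maps of the triod are represented by total functions on the complex numbers of which only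
  the values on \<^const>\<open>triod\<close> matter.\<close>

definition triod_maps :: "(complex \<Rightarrow> complex) set" where
  "triod_maps = {f. continuous_on triod f \<and> f ` triod \<subseteq> triod \<and> (\<forall>x\<in>triod. f x = x \<longleftrightarrow> x = 0)}"


section \<open>Cycles and patterns\<close>

definition periodic_orbit :: "(complex \<Rightarrow> complex) \<Rightarrow> complex set \<Rightarrow> bool" where
  "periodic_orbit f P \<longleftrightarrow>
     (\<exists>x\<in>triod. (\<exists>n>0. (f ^^ n) x = x) \<and> P = range (\<lambda>k. (f ^^ k) x))"

text \<open>A cycle always comes with the map of which it is a periodic orbit. Its period is
  \<^term>\<open>card P\<close>.\<close>

definition cycles :: "((complex \<Rightarrow> complex) \<times> complex set) set" where
  "cycles = {(f, P). f \<in> triod_maps \<and> periodic_orbit f P \<and> P \<noteq> {0}}"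

text \<open>The convex hull in the triod: the smallest connected subset of the triod containing the
  given set (intersections of connected subsets of a tree are connected).\<close>

definition triod_hull :: "complex set \<Rightarrow> complex set" where
  "triod_hull P = \<Inter> {C. connected C \<and> P \<subseteq> C \<and> C \<subseteq> triod}"

definition cycle_equiv ::
  "(((complex \<Rightarrow> complex) \<times> complex set) \<times> ((complex \<Rightarrow> complex) \<times> complex set)) set" where
  "cycle_equiv = {((f, P), (g, Q)). (f, P) \<in> cycles \<and> (g, Q) \<in> cycles \<and>
     (\<exists>h k. homeomorphism (triod_hull P) (triod_hull Q) h k \<and>
            h ` P = Q \<and>
            (\<forall>x\<in>P. h (f x) = g (h x)) \<and>
            (\<forall>B\<in>branches. h ` (B \<inter> triod_hull P) \<subseteq> B))}"

type_synonym pattern = "((complex \<Rightarrow> complex) \<times> complex set) set"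

definition patterns :: "pattern set" where
  "patterns = cycles // cycle_equiv"

definition pattern_of :: "(complex \<Rightarrow> complex) \<Rightarrow> complex set \<Rightarrow> pattern" where
  "pattern_of f P = cycle_equiv `` {(f, P)}"

definition forces :: "pattern \<Rightarrow> pattern \<Rightarrow> bool" where
  "forces A B \<longleftrightarrow>
     (\<forall>f\<in>triod_maps. (\<exists>P. (f, P) \<in> A) \<longrightarrow> (\<exists>Q. (f, Q) \<in> B))"

definition primitive_cycle :: "complex set \<Rightarrow> bool" where
  "primitive_cycle P \<longleftrightarrow> (\<forall>x\<in>P. \<forall>y\<in>P. x \<noteq> y \<longrightarrow> \<not> same_branch x y)"

definition primitive_pattern :: "pattern \<Rightarrow> bool" where
  "primitive_pattern A \<longleftrightarrow> (\<forall>(f, P)\<in>A. primitive_cycle P)"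

definition has_period :: "pattern \<Rightarrow> nat \<Rightarrow> bool" where
  "has_period A n \<longleftrightarrow> (\<forall>(f, P)\<in>A. card P = n)"

definition regular_pattern :: "pattern \<Rightarrow> bool" where
  "regular_pattern A \<longleftrightarrow>
     \<not> (\<exists>B\<in>patterns. primitive_pattern B \<and> has_period B 2 \<and> forces A B)"

definition regular_cycle :: "(complex \<Rightarrow> complex) \<Rightarrow> complex set \<Rightarrow> bool" where
  "regular_cycle f P \<longleftrightarrow> regular_pattern (pattern_of f P)"


section \<open>Numberings of the branches and rotation numbers\<close>

definition numbering :: "(nat \<Rightarrow> complex set) \<Rightarrow> bool" where
  "numbering b \<longleftrightarrow> bij_betw b {..<3} branches"

definition branch_index :: "(nat \<Rightarrow> complex set) \<Rightarrow> complex \<Rightarrow> nat" where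
  "branch_index b u = (THE i. i < 3 \<and> u \<in> b i)"

definition disp :: "(nat \<Rightarrow> complex set) \<Rightarrow> complex \<Rightarrow> complex \<Rightarrow> real" where
  "disp b u v = real_of_int ((int (branch_index b v) - int (branch_index b u)) mod 3) / 3"

text \<open>The number \<open>t\<^sub>k\<close>: the total displacement along the first \<open>k\<close> steps of the orbit
  of \<open>x\<close>.\<close>

definition total_disp ::
  "(nat \<Rightarrow> complex set) \<Rightarrow> (complex \<Rightarrow> complex) \<Rightarrow> complex \<Rightarrow> nat \<Rightarrow> real" where
  "total_disp b f x k = (\<Sum>j<k. disp b ((f ^^ j) x) ((f ^^ Suc j) x))"

text \<open>The rotation pair does not depend on the point \<open>x\<close> of the cycle used to compute it.\<close>

definition rotation_pair ::
  "(nat \<Rightarrow> complex set) \<Rightarrow> (complex \<Rightarrow> complex) \<Rightarrow> complex set \<Rightarrow> real \<times> nat" where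
  "rotation_pair b f P = (total_disp b f (SOME x. x \<in> P) (card P), card P)"

definition rotation_number ::
  "(nat \<Rightarrow> complex set) \<Rightarrow> (complex \<Rightarrow> complex) \<Rightarrow> complex set \<Rightarrow> real" where
  "rotation_number b f P = fst (rotation_pair b f P) / real (snd (rotation_pair b f P))"

definition pattern_rotation_number :: "(nat \<Rightarrow> complex set) \<Rightarrow> pattern \<Rightarrow> real" where
  "pattern_rotation_number b A = (THE r. \<forall>(f, P)\<in>A. rotation_number b f P = r)"

definition black :: "(nat \<Rightarrow> complex set) \<Rightarrow> (complex \<Rightarrow> complex) \<Rightarrow> complex \<Rightarrow> bool" where
  "black b f x \<longleftrightarrow> disp b x (f x) = 1 / 3"

text \<open>A canonical numbering in particular requires a point of the cycle on every branch. Regular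
  cycles always meet all three branches: a cycle on two branches forces a primitive pattern of
  period 2.\<close>

definition canonical_for_cycle ::
  "(nat \<Rightarrow> complex set) \<Rightarrow> (complex \<Rightarrow> complex) \<Rightarrow> complex set \<Rightarrow> bool" where
  "canonical_for_cycle b f P \<longleftrightarrow> numbering b \<and>
     (\<forall>i<3. \<exists>x\<in>P \<inter> b i. (\<forall>y\<in>P \<inter> b i. dist 0 x \<le> dist 0 y) \<and> black b f x)"

definition canonical_for_pattern :: "(nat \<Rightarrow> complex set) \<Rightarrow> pattern \<Rightarrow> bool" where
  "canonical_for_pattern b A \<longleftrightarrow> (\<forall>(f, P)\<in>A. canonical_for_cycle b f P)"


section \<open>Triod twists, green patterns and code functions\<close>

definition triod_twist :: "(nat \<Rightarrow> complex set) \<Rightarrow> pattern \<Rightarrow> bool" where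
  "triod_twist b A \<longleftrightarrow> A \<in> patterns \<and> regular_pattern A \<and>
     \<not> (\<exists>B\<in>patterns. B \<noteq> A \<and> forces A B \<and>
          pattern_rotation_number b B = pattern_rotation_number b A)"

definition green_cycle :: "(complex \<Rightarrow> complex) \<Rightarrow> complex set \<Rightarrow> bool" where
  "green_cycle f P \<longleftrightarrow> regular_cycle f P \<and>
     (\<forall>x\<in>P. \<forall>y\<in>P. farther x y \<and> same_branch (f x) (f y) \<longrightarrow> farther (f x) (f y))"

definition green_pattern :: "pattern \<Rightarrow> bool" where
  "green_pattern A \<longleftrightarrow> (\<forall>(f, P)\<in>A. green_cycle f P)"

text \<open>\<open>\<psi>\<close> is a code function of the cycle: the one obtained from some choice of the initial
  point \<open>x\<^sub>0\<close>. Another choice changes differences of values only between points of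
  different branches, so the monotonicity properties below do not depend on it.\<close>

definition code_function ::
  "(nat \<Rightarrow> complex set) \<Rightarrow> (complex \<Rightarrow> complex) \<Rightarrow> complex set \<Rightarrow> (complex \<Rightarrow> real) \<Rightarrow> bool" where
  "code_function b f P \<psi> \<longleftrightarrow>
     (\<exists>x\<^sub>0\<in>P. \<psi> x\<^sub>0 = 0 \<and>
        (\<forall>k. \<psi> ((f ^^ k) x\<^sub>0) =
               \<psi> x\<^sub>0 + real k * rotation_number b f P - real_of_int \<lfloor>total_disp b f x\<^sub>0 k\<rfloor>))"

definition code_nondecreasing ::
  "(nat \<Rightarrow> complex set) \<Rightarrow> (complex \<Rightarrow> complex) \<Rightarrow> complex set \<Rightarrow> (complex \<Rightarrow> real) \<Rightarrow> bool" where
  "code_nondecreasing b f P \<psi> \<longleftrightarrow>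
     (rotation_number b f P < 1 / 3 \<longrightarrow> (\<forall>x\<in>P. \<forall>y\<in>P. farther x y \<longrightarrow> \<psi> x \<le> \<psi> y)) \<and>
     (rotation_number b f P > 1 / 3 \<longrightarrow> (\<forall>x\<in>P. \<forall>y\<in>P. farther x y \<longrightarrow> \<psi> x \<ge> \<psi> y))"

definition consecutive :: "complex set \<Rightarrow> complex \<Rightarrow> complex \<Rightarrow> bool" where
  "consecutive P x y \<longleftrightarrow> x \<in> P \<and> y \<in> P \<and> farther x y \<and>
     \<not> (\<exists>z\<in>P. farther x z \<and> farther z y)"

definition code_strictly_increasing ::
  "(nat \<Rightarrow> complex set) \<Rightarrow> (complex \<Rightarrow> complex) \<Rightarrow> complex set \<Rightarrow> (complex \<Rightarrow> real) \<Rightarrow> bool" where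
  "code_strictly_increasing b f P \<psi> \<longleftrightarrow> code_nondecreasing b f P \<psi> \<and>
     (\<forall>x y. consecutive P x y \<longrightarrow> \<psi> x \<noteq> \<psi> y)"

definition has_strictly_increasing_code :: "(nat \<Rightarrow> complex set) \<Rightarrow> pattern \<Rightarrow> bool" where
  "has_strictly_increasing_code b A \<longleftrightarrow>
     (\<forall>(f, P)\<in>A. \<exists>\<psi>. code_function b f P \<psi> \<and> code_strictly_increasing b f P \<psi>)"

end

theory Submission
  imports Defs
begin

text \<open>
  Let \<open>P\<close> be a cycle of \<open>f\<close> with rotation number \<open>\<rho>\<close>. Up to constants on the branches, the code function
  is a potential \<open>\<Psi>\<close> with \<open>\<Psi> (f x) = \<Psi> x + \<rho> - d(x, f x)\<close>.

  If \<open>\<Psi>\<close> is strictly monotone on every branch, let \<open>F\<close> agree with \<open>f\<close> on \<open>P\<close> and vanish outside small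
  neighbourhoods of the points of \<open>P\<close>. A cycle of \<open>F\<close> follows points \<open>x\<^sub>k\<close> of \<open>P\<close> with
  \<open>x\<^sub>k\<^sub>+\<^sub>1 \<le> f x\<^sub>k\<close>. If its rotation number is \<open>\<rho>\<close>, summing the potential along the
  cycle shows that all these inequalities are equalities, and the cycle is \<open>P\<close>. Hence \<open>F\<close> has no other
  cycle with this rotation number. Strict monotonicity of \<open>\<Psi>\<close> also implies that \<open>P\<close> is green.

  If \<open>\<Psi>\<close> is not strictly monotone, two points \<open>x < f\<^sup>m x\<close> of one branch violate it. Replacing \<open>f\<^sup>m x\<close>
  by \<open>x\<close> and inserting turns around the innermost (black) points produces a closed sequence in \<open>P\<close> with
  \<open>x\<^sub>k\<^sub>+\<^sub>1 \<le> f x\<^sub>k\<close> whose average displacement is exactly \<open>\<rho>\<close>, but whose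
  itinerary is not that of a point of \<open>P\<close>. Made as small as possible, it traps a periodic orbit of
  every map with a cycle equivalent to \<open>P\<close>: the limit of the pull-backs of the \<open>x\<^sub>k\<close> under the largest
  right inverses of the map along the branches. As these inverses are monotone, the points of this
  orbit are ordered lexicographically by their itineraries, so its pattern does not depend on the
  map, and \<open>P\<close> forces it.
\<close>

section \<open>Coordinates on the triod\<close>

text \<open>Polar coordinates: the branch is read off \<open>sgn\<close> and the position on it off
  \<open>norm\<close>, in which all later geometry is expressed.\<close>

lemma mem_triod_iff: "z \<in> triod \<longleftrightarrow> norm z \<le> 1 \<and> (z = 0 \<or> sgn z ^ 3 = 1)"
proof
  assume "z \<in> triod"
  then obtain r where r: "0 \<le> r" "r \<le> 1" "z ^ 3 = complex_of_real r"
    unfolding triod_def by auto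
  have n: "norm z ^ 3 = r"
    using r by (metis abs_of_nonneg norm_of_real norm_power)
  have "norm z \<le> 1"
    using n r(2) power_less_imp_less_base[of 1 3 "norm z"] one_less_power[of "norm z" 3] by fastforce
  moreover have "sgn z ^ 3 = 1" if "z \<noteq> 0"
  proof -
    have "complex_of_real (norm z) ^ 3 = z ^ 3"
      using n r(3) by (metis of_real_power)
    then show ?thesis
      using that by (simp only: sgn_eq power_divide) simp
  qed
  ultimately show "norm z \<le> 1 \<and> (z = 0 \<or> sgn z ^ 3 = 1)" by auto
next
  assume a: "norm z \<le> 1 \<and> (z = 0 \<or> sgn z ^ 3 = 1)"
  have "z ^ 3 = complex_of_real (norm z ^ 3)"
  proof (cases "z = 0")
    case False
    then have "(z / of_real (norm z)) ^ 3 = 1" using a by (simp add: sgn_eq[symmetric])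
    then have "z ^ 3 / of_real (norm z) ^ 3 = 1" by (simp only: power_divide)
    then show ?thesis using False by simp
  qed auto
  then show "z \<in> triod"
    using a unfolding triod_def by (intro CollectI image_eqI[of _ _ "norm z ^ 3"]) (simp_all add: power_le_one)
qed

lemma cube_root_norm: "w ^ 3 = 1 \<Longrightarrow> norm (w :: complex) = 1"
  by (metis norm_ge_zero norm_one norm_power power_eq_1_iff zero_neq_numeral)

lemma cube_root_sgn: "w ^ 3 = 1 \<Longrightarrow> sgn (w :: complex) = w"
  by (simp add: sgn_eq cube_root_norm)

lemma sgn_scale_cube_root: "w ^ 3 = 1 \<Longrightarrow> 0 < t \<Longrightarrow> sgn (t *\<^sub>R (w :: complex)) = w"
  by (simp add: sgn_scaleR cube_root_sgn)

lemma scale_cube_root_mem_triod: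
  "w ^ 3 = 1 \<Longrightarrow> 0 \<le> t \<Longrightarrow> t \<le> 1 \<Longrightarrow> t *\<^sub>R w \<in> triod"
  by (cases "t = 0") (auto simp: mem_triod_iff sgn_scale_cube_root cube_root_norm)

lemma norm_scaleR_sgn: "norm z *\<^sub>R sgn z = (z :: complex)"
  by (cases "z = 0") (simp_all add: sgn_div_norm)

lemma sgn_norm_eqI: "sgn x = sgn y \<Longrightarrow> norm x = norm y \<Longrightarrow> (x :: complex) = y"
  by (metis norm_scaleR_sgn)

lemma triod_scaleR: "z \<in> triod \<Longrightarrow> 0 \<le> t \<Longrightarrow> t \<le> 1 \<Longrightarrow> t *\<^sub>R z \<in> triod"
  by (auto simp: mem_triod_iff sgn_scaleR mult_le_one sgn_if split: if_splits)

text \<open>The quotient \<open>c\<close> of distinct cube roots satisfies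
  \<open>c^2 + c + 1 = 0\<close>, and \<open>cnj c\<close> is its inverse, so
  \<open>2 * Re c = -1\<close>.\<close>

lemma inner_cube_roots:
  fixes w v :: complex
  assumes "w ^ 3 = 1" "v ^ 3 = 1" "w \<noteq> v"
  shows "inner w v = - 1 / 2"
proof -
  define c where "c = w * cnj v"
  have n: "norm w = 1" "norm v = 1" using assms cube_root_norm by auto
  have v: "v * cnj v = 1"
    using n by (simp add: complex_mult_cnj cmod_power2[symmetric] flip: of_real_power of_real_add)
  have c3: "c ^ 3 = 1"
    unfolding c_def by (simp add: power_mult_distrib assms flip: complex_cnj_power)
  have "c \<noteq> 1"
    using v assms(3) unfolding c_def by (metis mult.commute mult.assoc mult.right_neutral mult_cancel_right zero_neq_one)
  have "(c - 1) * (c ^ 2 + c + 1) = 0"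
    using c3 by (simp add: algebra_simps power2_eq_square power3_eq_cube)
  then have q: "c ^ 2 + c + 1 = 0" using \<open>c \<noteq> 1\<close> by simp
  have cn: "c * cnj c = 1"
    using cube_root_norm[OF c3] by (simp add: complex_mult_cnj cmod_power2[symmetric] flip: of_real_power of_real_add)
  have "c + cnj c = -1"
  proof -
    have "c * (c + cnj c + 1) = 0"
      using q cn by (simp add: algebra_simps power2_eq_square)
    then show ?thesis using cn by (metis add_eq_0_iff2 mult_eq_0_iff mult_zero_left zero_neq_one)
  qed
  then have "2 * Re c = -1"
    by (metis Re_complex_of_real complex_add_cnj of_real_minus of_real_1)
  moreover have "Re c = inner w v" unfolding c_def by (simp add: inner_complex_def)
  ultimately show ?thesis by simp
qed

text \<open>Projection to one branch direction is positive on that branch only and \<open>0\<close>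
  only at the centre; it turns questions on the triod into intermediate value arguments on the
  line.\<close>

lemma inner_triod:
  assumes "w ^ 3 = 1" "z \<in> triod"
  shows "inner w z = (if z = 0 \<or> sgn z = w then norm z else - norm z / 2)"
proof (cases "z = 0")
  case False
  then have s: "sgn z ^ 3 = 1" using assms mem_triod_iff by auto
  have "inner w z = norm z * inner w (sgn z)"
    by (metis inner_scaleR_right norm_scaleR_sgn)
  moreover have "inner w w = 1" using cube_root_norm[OF assms(1)] by (simp add: norm_eq_1)
  ultimately show ?thesis using False inner_cube_roots[OF assms(1) s] by auto
qed simp

lemma inner_triod_pos:
  assumes "w ^ 3 = 1" "z \<in> triod" "0 < inner w z"
  shows "z = inner w z *\<^sub>R w"
proof -
  have "z = 0 \<or> sgn z = w"
    using assms(3) unfolding inner_triod[OF assms(1,2)] by (auto split: if_splits)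
  then show ?thesis
    using assms(3) norm_scaleR_sgn[of z] unfolding inner_triod[OF assms(1,2)] by auto
qed

lemma inner_triod_eq_0: "w ^ 3 = 1 \<Longrightarrow> z \<in> triod \<Longrightarrow> inner w z = 0 \<Longrightarrow> z = 0"
  by (simp add: inner_triod split: if_splits)

section \<open>Branches as components of the punctured triod\<close>

lemma finite_cube_roots: "finite {w :: complex. w ^ 3 = 1}"
  using finite_roots_unity[of 3] by simp

text \<open>Away from \<open>0\<close> the direction is continuous with finitely many values, so
  connectedness freezes it.\<close>

lemma connected_sgn_const:
  assumes "connected C" "C \<subseteq> triod - {0}" "x \<in> C" "y \<in> C"
  shows "sgn x = sgn y"
proof -
  have "continuous_on C sgn"
    using assms(2) by (intro continuous_on_sgn continuous_on_id) auto
  then have "connected (sgn ` C)" using assms(1) connected_continuous_image by blast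
  moreover have "sgn ` C \<subseteq> {w. w ^ 3 = 1}"
    using assms(2) by (auto simp: mem_triod_iff)
  then have "finite (sgn ` C)" using finite_cube_roots finite_subset by blast
  ultimately have "\<exists>a. sgn ` C \<subseteq> {a}"
    using connected_finite_iff_sing[of "sgn ` C"] by auto
  then show ?thesis using assms(3,4) by blast
qed

lemma component_triod:
  assumes "x \<in> triod - {0}"
  shows "connected_component_set (triod - {0}) x = {z \<in> triod - {0}. sgn z = sgn x}"
proof
  show "connected_component_set (triod - {0}) x \<subseteq> {z \<in> triod - {0}. sgn z = sgn x}"
  proof
    fix z assume "z \<in> connected_component_set (triod - {0}) x"
    then obtain C where "connected C" "C \<subseteq> triod - {0}" "x \<in> C" "z \<in> C"
      by (auto simp: connected_component_def)
    then show "z \<in> {z \<in> triod - {0}. sgn z = sgn x}" using connected_sgn_const by blast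
  qed
next
  define w where "w = sgn x"
  have w: "w ^ 3 = 1" using assms by (auto simp: w_def mem_triod_iff)
  have eq: "{z \<in> triod - {0}. sgn z = w} = (\<lambda>t. t *\<^sub>R w) ` {0<..1}"
  proof (intro equalityI subsetI)
    fix z assume z: "z \<in> {z \<in> triod - {0}. sgn z = w}"
    then have "z = norm z *\<^sub>R w" using norm_scaleR_sgn by force
    then show "z \<in> (\<lambda>t. t *\<^sub>R w) ` {0<..1}"
      using z by (intro image_eqI[of _ _ "norm z"]) (auto simp: mem_triod_iff)
  next
    fix z assume "z \<in> (\<lambda>t. t *\<^sub>R w) ` {0<..1}"
    then show "z \<in> {z \<in> triod - {0}. sgn z = w}"
      using w scale_cube_root_mem_triod[OF w] sgn_scale_cube_root[OF w] by auto
  qed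
  have "connected ((\<lambda>t. t *\<^sub>R w) ` {0<..1})"
    by (intro connected_continuous_image continuous_intros) auto
  then have "connected {z \<in> triod - {0}. sgn z = w}" unfolding eq .
  then show "{z \<in> triod - {0}. sgn z = sgn x} \<subseteq> connected_component_set (triod - {0}) x"
    using assms by (intro connected_component_maximal) (auto simp: w_def)
qed

lemma branches_eq: "branches = (\<lambda>w. {z \<in> triod - {0}. sgn z = w}) ` {w. w ^ 3 = 1}"
proof -
  have "w \<in> sgn ` (triod - {0})" if "w ^ 3 = 1" for w :: complex
    using that cube_root_norm cube_root_sgn
    by (intro image_eqI[of _ _ w]) (auto simp: mem_triod_iff)
  then have "sgn ` (triod - {0}) = {w :: complex. w ^ 3 = 1}"
    by (auto simp: mem_triod_iff)
  moreover have "connected_component_set (triod - {0}) ` (triod - {0}) =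
      (\<lambda>w. {z \<in> triod - {0}. sgn z = w}) ` sgn ` (triod - {0})"
    unfolding image_image by (intro image_cong refl component_triod)
  ultimately show ?thesis
    unfolding branches_def components_def by simp
qed

lemma same_branch_iff:
  "same_branch x y \<longleftrightarrow> x \<in> triod - {0} \<and> y \<in> triod - {0} \<and> sgn x = sgn y"
  unfolding same_branch_def branches_eq by (auto simp: mem_triod_iff)

lemma farther_iff:
  "farther x y \<longleftrightarrow> x \<in> triod - {0} \<and> y \<in> triod - {0} \<and> sgn x = sgn y \<and> norm y < norm x"
  unfolding farther_def same_branch_iff by auto

section \<open>Maps and cycles\<close>

lemma triod_mapsD:
  assumes "f \<in> triod_maps"
  shows "continuous_on triod f" "x \<in> triod \<Longrightarrow> f x \<in> triod" "f 0 = 0"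
    "x \<in> triod \<Longrightarrow> f x = x \<Longrightarrow> x = 0"
proof -
  have z: "0 \<in> triod" by (simp add: mem_triod_iff)
  show "continuous_on triod f" "x \<in> triod \<Longrightarrow> f x \<in> triod" "f 0 = 0"
    "x \<in> triod \<Longrightarrow> f x = x \<Longrightarrow> x = 0"
    using assms z unfolding triod_maps_def by blast+
qed

text \<open>Otherwise \<open>g\<close> changes sign between \<open>x\<close> and the tip of the
  branch, and its zero is a fixed point other than \<open>0\<close>.\<close>

lemma green_moves_inward:
  assumes f: "f \<in> triod_maps" and x: "x \<in> triod" "x \<noteq> 0" and "sgn (f x) = sgn x"
  shows "norm (f x) < norm x"
proof (rule ccontr)
  assume c: "\<not> norm (f x) < norm x"
  define w where "w = sgn x"
  have w: "w ^ 3 = 1" using x by (auto simp: w_def mem_triod_iff)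
  have x1: "norm x \<le> 1" using x mem_triod_iff by auto
  define g where "g t = t - inner w (f (t *\<^sub>R w))" for t
  have cont: "continuous_on {norm x..1} g"
    unfolding g_def
    by (intro continuous_intros continuous_on_compose2[OF triod_mapsD(1)[OF f]])
       (auto intro!: scale_cube_root_mem_triod w order_trans[OF norm_ge_zero])
  have "f x \<in> triod" using triod_mapsD f x by blast
  then have "inner w (f x) = norm (f x)"
    using inner_triod[OF w] assms(4) by (auto simp: w_def)
  moreover have "norm x *\<^sub>R w = x" by (simp add: w_def norm_scaleR_sgn)
  ultimately have g0: "g (norm x) \<le> 0" using c by (simp add: g_def)
  have "inner w (f (1 *\<^sub>R w)) \<le> 1"
  proof -
    have "f (1 *\<^sub>R w) \<in> triod" using triod_mapsD(2)[OF f] scale_cube_root_mem_triod[OF w, of 1] by auto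
    then have "norm (f (1 *\<^sub>R w)) \<le> 1" by (simp add: mem_triod_iff)
    then show ?thesis
      using norm_cauchy_schwarz[of w "f (1 *\<^sub>R w)"] cube_root_norm[OF w] by auto
  qed
  then have g1: "0 \<le> g 1" by (simp add: g_def)
  obtain t where t: "norm x \<le> t" "t \<le> 1" "g t = 0"
    using IVT'[OF g0 g1 x1 cont] by auto
  have tpos: "0 < t" using t(1) x(2) by (metis less_le_trans zero_less_norm_iff)
  have tm: "t *\<^sub>R w \<in> triod" using scale_cube_root_mem_triod w t tpos by auto
  then have "f (t *\<^sub>R w) = t *\<^sub>R w"
    using inner_triod_pos[OF w triod_mapsD(2)[OF f tm]] t(3) tpos by (simp add: g_def)
  then have "t *\<^sub>R w = 0" using triod_mapsD(4)[OF f tm] by blast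
  then show False using tpos w by auto
qed

section \<open>Elementary properties of cycles\<close>

locale cycle =
  fixes f :: "complex \<Rightarrow> complex" and P :: "complex set"
  assumes mem_cycles: "(f, P) \<in> cycles"
begin

lemma map: "f \<in> triod_maps"
  using mem_cycles by (simp add: cycles_def)

lemma image_eq: "f ` P = P"
  and triod: "P \<subseteq> triod - {0}"
  and finite: "finite P"
  and nonempty: "P \<noteq> {}"
  and orbit: "x \<in> P \<Longrightarrow> (f ^^ card P) x = x \<and> bij_betw (\<lambda>k. (f ^^ k) x) {..<card P} P"
proof -
  obtain x0 n where x0: "x0 \<in> triod" "0 < n" "(f ^^ n) x0 = x0" "P = range (\<lambda>k. (f ^^ k) x0)" "P \<noteq> {0}"
    using mem_cycles by (auto simp: cycles_def periodic_orbit_def)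
  have fP: "f x \<in> P" if xP: "x \<in> P" for x
  proof -
    obtain k where "x = (f ^^ k) x0" using xP x0(4) by auto
    then have "f x = (f ^^ Suc k) x0" by simp
    then show ?thesis using x0(4) by blast
  qed
  have main: "(f ^^ card P) x = x \<and> bij_betw (\<lambda>k. (f ^^ k) x) {..<card P} P" if xP: "x \<in> P" for x
  proof -
    obtain k where k: "x = (f ^^ k) x0" using xP x0(4) by auto
    have nx: "(f ^^ n) x = x"
      unfolding k by (metis add.commute funpow_add o_apply x0(3))
    define m where "m = (LEAST m. 0 < m \<and> (f ^^ m) x = x)"
    have m: "0 < m" "(f ^^ m) x = x"
      using LeastI[of "\<lambda>m. 0 < m \<and> (f ^^ m) x = x" n] nx x0(2) unfolding m_def by auto
    have least: "m \<le> j" if "0 < j" "(f ^^ j) x = x" for j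
      unfolding m_def using that by (intro Least_le) auto
    have inj: "inj_on (\<lambda>k. (f ^^ k) x) {..<m}"
    proof (rule linorder_inj_onI)
      fix i j assume ij: "i < j" "i \<in> {..<m}" "j \<in> {..<m}"
      show "(f ^^ i) x \<noteq> (f ^^ j) x"
      proof
        assume e: "(f ^^ i) x = (f ^^ j) x"
        have "(f ^^ (m - j + i)) x = (f ^^ (m - j + j)) x"
          unfolding funpow_add o_apply e by simp
        then have "(f ^^ (m - j + i)) x = x" using ij m by simp
        then show False using least[of "m - j + i"] ij by auto
      qed
    qed auto
    have rng: "(\<lambda>k. (f ^^ k) x) ` {..<m} = range (\<lambda>k. (f ^^ k) x)"
    proof (intro equalityI subsetI)
      fix y assume "y \<in> range (\<lambda>k. (f ^^ k) x)"
      then obtain j where "y = (f ^^ j) x" by auto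
      then have "y = (f ^^ (j mod m)) x" using funpow_mod_eq[OF m(2)] by simp
      then show "y \<in> (\<lambda>k. (f ^^ k) x) ` {..<m}" using m(1) by auto
    qed auto
    have "range (\<lambda>k. (f ^^ k) x) = P"
    proof (intro equalityI subsetI)
      fix y assume "y \<in> P"
      then obtain j where j: "y = (f ^^ j) x0" using x0(4) by auto
      \<comment> \<open>Since \<open>x\<close> is already \<open>k\<close> steps ahead of
        \<open>x0\<close>, the extra \<open>k * (n - 1)\<close> steps complete \<open>k\<close>
        returns to \<open>x0\<close>.\<close>
      have "(f ^^ (j + k * (n - 1))) x = (f ^^ (j + n * k)) x0"
      proof -
        have "n * k = k * (n - 1) + k" using x0(2) by (cases n) auto
        then have "j + n * k = (j + k * (n - 1)) + k" by linarith
        then show ?thesis unfolding k by (metis funpow_add o_apply)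
      qed
      also have "\<dots> = y"
        unfolding funpow_add o_apply j using funpow_mod_eq[OF x0(3), of "n * k"] by simp
      finally show "y \<in> range (\<lambda>k. (f ^^ k) x)" by auto
    next
      fix y assume "y \<in> range (\<lambda>k. (f ^^ k) x)"
      then obtain j where "y = (f ^^ j) x" by auto
      then have "y = (f ^^ (j + k)) x0" unfolding k by (simp add: funpow_add)
      then show "y \<in> P" using x0(4) by auto
    qed
    then have b: "bij_betw (\<lambda>k. (f ^^ k) x) {..<m} P"
      using inj rng by (simp add: bij_betw_def)
    then have "card P = m" using bij_betw_same_card by fastforce
    then show ?thesis using b m by simp
  qed
  then show "x \<in> P \<Longrightarrow> (f ^^ card P) x = x \<and> bij_betw (\<lambda>k. (f ^^ k) x) {..<card P} P" .
  have x0P: "x0 \<in> P" unfolding x0(4) by (auto intro!: image_eqI[of _ _ 0])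
  then show "P \<noteq> {}" by blast
  show "finite P" using main[OF x0P] bij_betw_finite by blast
  show "f ` P = P"
  proof (intro equalityI subsetI)
    fix y assume y: "y \<in> P"
    then have "card P > 0" using \<open>finite P\<close> card_gt_0_iff by blast
    then have "y = f ((f ^^ (card P - 1)) y)"
      using main[OF y] by (metis Suc_diff_1 funpow.simps(2) o_apply)
    moreover have "(f ^^ j) y \<in> P" for j by (induction j) (auto simp: y fP)
    ultimately show "y \<in> f ` P" by blast
  qed (auto simp: fP)
  have T: "P \<subseteq> triod"
  proof -
    have "(f ^^ k) x0 \<in> triod" for k
      by (induction k) (auto simp: x0(1) triod_mapsD(2)[OF map])
    then show ?thesis using x0(4) by auto
  qed
  have "0 \<notin> P"
  proof
    assume z: "0 \<in> P"
    have "(f ^^ k) 0 = 0" for k by (induction k) (auto simp: triod_mapsD(3)[OF map])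
    then have "P = {0}" using main[OF z] z unfolding bij_betw_def by auto
    then show False using x0(5) by simp
  qed
  then show "P \<subseteq> triod - {0}" using T by auto
qed

lemma map_mem: "x \<in> P \<Longrightarrow> f x \<in> P"
  using image_eq by blast

lemma funpow_mem: "x \<in> P \<Longrightarrow> (f ^^ k) x \<in> P"
  by (induction k) (auto simp: map_mem)

lemma inj: "inj_on f P"
  using image_eq finite by (simp add: eq_card_imp_inj_on)

lemma sgn_cube: "x \<in> P \<Longrightarrow> sgn x ^ 3 = 1"
  using triod by (auto simp: mem_triod_iff)

lemma card_pos: "0 < card P"
  using finite nonempty by (simp add: card_gt_0_iff)

lemma reach: "x \<in> P \<Longrightarrow> y \<in> P \<Longrightarrow> \<exists>m<card P. y = (f ^^ m) x"
  using orbit[of x] unfolding bij_betw_def by auto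

lemma return_dvd:
  assumes "x \<in> P" "(f ^^ M) x = x"
  shows "card P dvd M"
proof -
  have "(f ^^ (M mod card P)) x = (f ^^ 0) x"
    using funpow_mod_eq[of "card P" f x M] orbit[OF assms(1)] assms(2) by simp
  then have "M mod card P = 0"
    using orbit[OF assms(1)] card_pos unfolding bij_betw_def inj_on_def by (metis lessThan_iff mod_less_divisor)
  then show ?thesis by auto
qed

text \<open>On a single branch every point of the cycle would be green and hence move inwards, which
  is impossible for the innermost one. This puts the branching point into the hull of every
  cycle.\<close>

lemma two_branches: "x \<in> P \<Longrightarrow> \<exists>y\<in>P. sgn y \<noteq> sgn x"
proof (rule ccontr)
  assume "x \<in> P" and c: "\<not> (\<exists>y\<in>P. sgn y \<noteq> sgn x)"
  obtain y where y: "y \<in> P" "\<And>z. z \<in> P \<Longrightarrow> norm y \<le> norm z"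
    using finite nonempty by (metis (no_types, lifting) arg_min_if_finite(1) arg_min_least)
  have "sgn (f y) = sgn y" using c y(1) map_mem by simp
  then have "norm (f y) < norm y"
    using y(1) triod by (intro green_moves_inward map) auto
  then show False using y map_mem by force
qed

end

section \<open>Equivalence of cycles\<close>

lemma closed_segment_0:
  fixes p :: complex
  shows "closed_segment 0 p = (\<lambda>s. s *\<^sub>R sgn p) ` {0..norm p}"
proof (cases "p = 0")
  case False
  show ?thesis
  proof (intro equalityI subsetI)
    fix z assume "z \<in> closed_segment 0 p"
    then obtain u where u: "0 \<le> u" "u \<le> 1" "z = u *\<^sub>R p"
      by (auto simp: in_segment)
    have "z = (u * norm p) *\<^sub>R sgn p"
      using u(3) norm_scaleR_sgn[of p] by (metis scaleR_scaleR)
    then show "z \<in> (\<lambda>s. s *\<^sub>R sgn p) ` {0..norm p}"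
      using u mult_left_le_one_le[of "norm p" u] by auto
  next
    fix z assume "z \<in> (\<lambda>s. s *\<^sub>R sgn p) ` {0..norm p}"
    then obtain s where s: "0 \<le> s" "s \<le> norm p" "z = s *\<^sub>R sgn p" by auto
    then have "z = (s / norm p) *\<^sub>R p" using False by (simp add: sgn_div_norm divide_inverse)
    then show "z \<in> closed_segment 0 p"
      using s False by (auto simp: in_segment divide_simps intro!: exI[of _ "s / norm p"])
  qed
qed auto

lemma closed_segment_0_subset_triod: "p \<in> triod \<Longrightarrow> closed_segment 0 p \<subseteq> triod"
  using triod_scaleR by (auto simp: in_segment)

text \<open>The union of the segments is connected. Conversely, a connected set containing
  \<open>p\<close> and a point of another branch projects onto all values between \<open>0\<close>
  and \<open>norm p\<close> in the direction of \<open>p\<close>, and each of these values has only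
  one preimage in the triod.\<close>

lemma triod_hull_eq:
  assumes P: "P \<subseteq> triod - {0}" and xy: "x \<in> P" "y \<in> P" "sgn x \<noteq> sgn y"
  shows "triod_hull P = (\<Union>p\<in>P. closed_segment 0 p)" (is "_ = ?S")
proof
  have "connected ?S"
    by (rule connected_Union[of "closed_segment 0 ` P"]) auto
  moreover have "P \<subseteq> ?S" by auto
  moreover have "?S \<subseteq> triod" using P closed_segment_0_subset_triod by blast
  ultimately show "triod_hull P \<subseteq> ?S" unfolding triod_hull_def by blast
next
  show "?S \<subseteq> triod_hull P"
    unfolding triod_hull_def
  proof (intro subsetI InterI)
    fix z C assume z: "z \<in> ?S" and "C \<in> {C. connected C \<and> P \<subseteq> C \<and> C \<subseteq> triod}"
    then have C: "connected C" "P \<subseteq> C" "C \<subseteq> triod" by auto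
    obtain p where p: "p \<in> P" "z \<in> closed_segment 0 p" using z by auto
    define w where "w = sgn p"
    have w: "w ^ 3 = 1" using p(1) P by (auto simp: w_def mem_triod_iff)
    obtain s where s: "0 \<le> s" "s \<le> norm p" "z = s *\<^sub>R w"
      using p(2) unfolding closed_segment_0 w_def by auto
    obtain q where q: "q \<in> P" "sgn q \<noteq> w" using xy by (cases "sgn x = w") auto
    have qT: "p \<in> triod" "q \<in> triod" using p(1) q(1) P by auto
    have "connected (inner w ` C)"
      by (intro connected_continuous_image C continuous_intros)
    moreover have "inner w p = norm p" "inner w q \<le> 0"
      using inner_triod[OF w, of p] inner_triod[OF w, of q] qT q(2)
      by (auto simp: w_def[symmetric])
    moreover have "inner w p \<in> inner w ` C" "inner w q \<in> inner w ` C" using p(1) q(1) C(2) by auto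
    moreover have "inner w q \<le> s" "s \<le> inner w p" using calculation(2,3) s by auto
    ultimately have "s \<in> inner w ` C"
      unfolding connected_iff_interval by blast
    then obtain c where c: "c \<in> C" "inner w c = s" by auto
    show "z \<in> C"
    proof (cases "s = 0")
      case True
      then show ?thesis using c C(3) inner_triod_eq_0[OF w, of c] s(3) by auto
    next
      case False
      then show ?thesis using c C(3) inner_triod_pos[OF w, of c] s by auto
    qed
  qed
qed

section \<open>Conjugations, the combinatorial form of equivalence\<close>

definition conjugation ::
  "(complex \<Rightarrow> complex) \<Rightarrow> complex set \<Rightarrow> (complex \<Rightarrow> complex) \<Rightarrow> complex set \<Rightarrow> (complex \<Rightarrow> complex) \<Rightarrow> bool"
  where "conjugation f P g Q h \<longleftrightarrow> h ` P = Q \<and> (\<forall>x\<in>P. h (f x) = g (h x)) \<and> (\<forall>x\<in>P. sgn (h x) = sgn x) \<and>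
    (\<forall>x\<in>P. \<forall>y\<in>P. sgn x = sgn y \<and> norm x < norm y \<longrightarrow> norm (h x) < norm (h y))"

lemma conjugationD:
  assumes "conjugation f P g Q h" "x \<in> P"
  shows "h x \<in> Q" "h (f x) = g (h x)" "sgn (h x) = sgn x"
  using assms by (auto simp: conjugation_def)

lemma conjugation_less_iff:
  assumes "conjugation f P g Q h" "x \<in> P" "y \<in> P" "sgn x = sgn y"
  shows "norm (h x) < norm (h y) \<longleftrightarrow> norm x < norm y"
  using assms unfolding conjugation_def
  by (metis linorder_neqE_linordered_idom order_less_asym order_less_irrefl sgn_norm_eqI)

lemma conjugation_le_iff:
  assumes "conjugation f P g Q h" "x \<in> P" "y \<in> P" "sgn x = sgn y"
  shows "norm (h x) \<le> norm (h y) \<longleftrightarrow> norm x \<le> norm y"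
  using conjugation_less_iff[OF assms(1,3,2)] assms(4) by (simp add: linorder_not_less[symmetric])

lemma conjugation_inj: "conjugation f P g Q h \<Longrightarrow> inj_on h P"
proof (rule inj_onI)
  fix x y assume c: "conjugation f P g Q h" and xy: "x \<in> P" "y \<in> P" "h x = h y"
  have "\<forall>x\<in>P. sgn (h x) = sgn x" using c by (simp add: conjugation_def)
  then have s: "sgn x = sgn y" using xy by metis
  have "norm x = norm y"
    using conjugation_le_iff[OF c xy(1,2) s] conjugation_le_iff[OF c xy(2,1) s[symmetric]] xy(3)
    by simp
  then show "x = y" by (rule sgn_norm_eqI[OF s])
qed

lemma conjugation_funpow:
  assumes "conjugation f P g Q h" "f ` P \<subseteq> P" "x \<in> P"
  shows "h ((f ^^ k) x) = (g ^^ k) (h x)"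
proof -
  have m: "(f ^^ k) x \<in> P" for k by (induction k) (use assms(2,3) in auto)
  show ?thesis
    by (induction k) (use assms(1) m in \<open>auto simp: conjugation_def\<close>)
qed

lemma conjugation_refl: "conjugation f P f P id"
  by (simp add: conjugation_def)

lemma conjugation_sym:
  assumes "conjugation f P g Q h" "f ` P \<subseteq> P"
  shows "conjugation g Q f P (inv_into P h)"
proof -
  note inj = conjugation_inj[OF assms(1)]
  have Q: "h ` P = Q" using assms(1) by (simp add: conjugation_def)
  have inv: "inv_into P h (h x) = x" if "x \<in> P" for x using inj that by simp
  show ?thesis
    unfolding conjugation_def Q[symmetric]
  proof (intro conjI ballI impI)
    show "inv_into P h ` h ` P = P" using inj by auto
    fix y assume "y \<in> h ` P"
    then obtain x where x: "x \<in> P" "y = h x" by auto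
    then have "g y = h (f x)" using assms(1) by (simp add: conjugation_def)
    then show "inv_into P h (g y) = f (inv_into P h y)"
      using x inv assms(2) by (simp add: image_subset_iff)
    show "sgn (inv_into P h y) = sgn y"
      using x inv assms(1) by (simp add: conjugation_def)
    fix y' assume "y' \<in> h ` P" "sgn y = sgn y' \<and> norm y < norm y'"
    then obtain x' where x': "x' \<in> P" "y' = h x'" "sgn y = sgn y'" "norm y < norm y'" by auto
    moreover have "sgn x = sgn x'" using assms(1) x x' by (simp add: conjugation_def)
    ultimately show "norm (inv_into P h y) < norm (inv_into P h y')"
      using x inv conjugation_less_iff[OF assms(1)] by simp
  qed
qed

lemma conjugation_trans:
  "conjugation f P g Q h \<Longrightarrow> conjugation g Q e R k \<Longrightarrow> conjugation f P e R (k \<circ> h)"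
  unfolding conjugation_def by (auto simp: image_comp[symmetric])

text \<open>When the largest node \<open>m\<close> is added, the function is kept up to the previous
  node \<open>s0\<close> (or \<open>0\<close>) and continued from there linearly with positive slope
  \<open>c\<close>.\<close>

lemma strict_mono_interpolation:
  fixes \<phi> :: "real \<Rightarrow> real"
  assumes "finite S"
  shows "\<lbrakk>\<forall>s\<in>S. 0 < s \<and> 0 < \<phi> s; strict_mono_on S \<phi>\<rbrakk> \<Longrightarrow>
    \<exists>\<eta>. continuous_on UNIV \<eta> \<and> \<eta> 0 = 0 \<and> strict_mono \<eta> \<and> (\<forall>s\<in>S. \<eta> s = \<phi> s)"
  using assms
proof (induction S rule: finite_linorder_max_induct)
  case empty
  then show ?case by (intro exI[of _ id]) (auto simp: strict_mono_def)
next
  case (insert m S)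
  have "strict_mono_on S \<phi>"
    using insert.prems(2) by (auto simp: strict_mono_on_def)
  then obtain \<eta> where \<eta>: "continuous_on UNIV \<eta>" "\<eta> 0 = 0" "strict_mono \<eta>" "\<forall>s\<in>S. \<eta> s = \<phi> s"
    using insert.IH insert.prems(1) by auto
  define s0 where "s0 = Max (insert 0 S)"
  have s0: "s0 \<in> insert 0 S" unfolding s0_def by (intro Max_in) (use insert.hyps in auto)
  have s0S: "s \<le> s0" if "s \<in> S" for s unfolding s0_def using that insert.hyps by (intro Max_ge) auto
  have s00: "0 \<le> s0" unfolding s0_def using insert.hyps by (intro Max_ge) auto
  have s0m: "s0 < m" using s0 insert.hyps(2) insert.prems(1) by auto
  have \<eta>m: "\<eta> s0 < \<phi> m"
  proof (cases "s0 = 0")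
    case False
    then have "s0 \<in> S" using s0 by auto
    then show ?thesis
      using \<eta>(4) s0m insert.prems(2) by (auto simp: strict_mono_on_def)
  qed (use \<eta>(2) insert.prems(1) in auto)
  define c where "c = (\<phi> m - \<eta> s0) / (m - s0)"
  have c: "0 < c" using \<eta>m s0m by (simp add: c_def)
  define \<eta>' where "\<eta>' t = \<eta> (min t s0) + c * max 0 (t - s0)" for t
  have "continuous_on UNIV \<eta>'"
    unfolding \<eta>'_def by (intro continuous_intros continuous_on_compose2[OF \<eta>(1)]) auto
  moreover have "\<eta>' 0 = 0" using s00 \<eta>(2) by (simp add: \<eta>'_def)
  moreover have "strict_mono \<eta>'"
  proof (rule strict_monoI)
    fix x y :: real assume xy: "x < y"
    have "\<eta> (min x s0) \<le> \<eta> (min y s0)" using xy by (intro strict_mono_leD[OF \<eta>(3)]) auto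
    moreover have "c * max 0 (x - s0) \<le> c * max 0 (y - s0)"
      using c xy by (intro mult_left_mono) auto
    moreover have "\<eta> (min x s0) < \<eta> (min y s0) \<or> c * max 0 (x - s0) < c * max 0 (y - s0)"
    proof (cases "x < s0")
      case True
      then have "min x s0 < min y s0" using xy by auto
      then show ?thesis using \<eta>(3) by (simp add: strict_monoD)
    next
      case False
      then have "max 0 (x - s0) < max 0 (y - s0)" using xy by auto
      then show ?thesis using c by simp
    qed
    ultimately show "\<eta>' x < \<eta>' y" unfolding \<eta>'_def by linarith
  qed
  moreover have "\<eta>' s = \<phi> s" if "s \<in> S" for s
    using s0S[OF that] \<eta>(4) that by (auto simp: \<eta>'_def min_def)
  moreover have "\<eta>' m = \<phi> m" using s0m by (simp add: \<eta>'_def c_def min_def)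
  ultimately show ?case by auto
qed

text \<open>The map keeps directions and acts on distances by a strictly increasing interpolation on
  each branch. Being continuous and injective on a compact set, it is a homeomorphism onto its
  image.\<close>

lemma homeomorphism_of_conjugation:
  assumes P: "P \<subseteq> triod - {0}" "finite P" and Q: "Q \<subseteq> triod - {0}"
    and h: "h ` P = Q" "\<forall>x\<in>P. sgn (h x) = sgn x"
    "\<forall>x\<in>P. \<forall>y\<in>P. sgn x = sgn y \<and> norm x < norm y \<longrightarrow> norm (h x) < norm (h y)"
  shows "\<exists>H K. homeomorphism (\<Union>p\<in>P. closed_segment 0 p) (\<Union>q\<in>Q. closed_segment 0 q) H K \<and>
    (\<forall>x\<in>P. H x = h x) \<and> (\<forall>B\<in>branches. H ` (B \<inter> (\<Union>p\<in>P. closed_segment 0 p)) \<subseteq> B)"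
proof -
  have "\<exists>\<eta>. continuous_on UNIV \<eta> \<and> \<eta> 0 = 0 \<and> strict_mono \<eta> \<and> (\<forall>p\<in>P. sgn p = w \<longrightarrow> \<eta> (norm p) = norm (h p))" for w
  proof -
    define S where "S = norm ` {p \<in> P. sgn p = w}"
    have S: "norm p *\<^sub>R w = p" if "p \<in> P" "sgn p = w" for p
      using that norm_scaleR_sgn by blast
    have "\<exists>\<eta>. continuous_on UNIV \<eta> \<and> \<eta> 0 = 0 \<and> strict_mono \<eta> \<and> (\<forall>s\<in>S. \<eta> s = norm (h (s *\<^sub>R w)))"
    proof (rule strict_mono_interpolation)
      show "finite S" unfolding S_def using P(2) by simp
      show "\<forall>s\<in>S. 0 < s \<and> 0 < norm (h (s *\<^sub>R w))"
        using P(1) Q h(1) by (auto simp: S_def S)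
      show "strict_mono_on S (\<lambda>s. norm (h (s *\<^sub>R w)))"
      proof (rule strict_mono_onI)
        fix s t assume "s \<in> S" "t \<in> S" "s < t"
        then obtain p q where "p \<in> P" "sgn p = w" "s = norm p" "q \<in> P" "sgn q = w" "t = norm q"
          by (auto simp: S_def)
        then show "norm (h (s *\<^sub>R w)) < norm (h (t *\<^sub>R w))"
          using h(3) \<open>s < t\<close> by (simp add: S)
      qed
    qed
    then show ?thesis by (fastforce simp: S_def S)
  qed
  then obtain \<eta> :: "complex \<Rightarrow> real \<Rightarrow> real" where \<eta>: "\<And>w. continuous_on UNIV (\<eta> w)" "\<And>w. \<eta> w 0 = 0"
    "\<And>w. strict_mono (\<eta> w)" "\<And>p. p \<in> P \<Longrightarrow> \<eta> (sgn p) (norm p) = norm (h p)"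
    by metis
  define H where "H z = \<eta> (sgn z) (norm z) *\<^sub>R sgn z" for z
  let ?S = "\<Union>p\<in>P. closed_segment 0 p" and ?R = "\<Union>q\<in>Q. closed_segment 0 q"
  have \<eta>0: "0 < \<eta> w t" if "0 < t" for w t
    using strict_monoD[OF \<eta>(3) that, of w] \<eta>(2) by simp
  have sgnH: "sgn (H z) = sgn z" and normH: "norm (H z) = \<eta> (sgn z) (norm z)" for z
  proof -
    have "sgn (H z) = sgn z \<and> norm (H z) = \<eta> (sgn z) (norm z)"
    proof (cases "z = 0")
      case False
      then have "0 < \<eta> (sgn z) (norm z)" using \<eta>0 by simp
      then show ?thesis using False by (simp add: H_def sgn_scaleR sgn_sgn norm_sgn)
    qed (simp add: H_def \<eta>)
    then show "sgn (H z) = sgn z" "norm (H z) = \<eta> (sgn z) (norm z)" by auto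
  qed
  have Hs: "H (s *\<^sub>R sgn p) = \<eta> (sgn p) s *\<^sub>R sgn p" if "0 \<le> s" for s p
    using that by (cases "s = 0") (auto simp: H_def \<eta> sgn_scaleR sgn_sgn norm_sgn)
  have contp: "continuous_on (closed_segment 0 p) H" for p
  proof -
    have "continuous_on (closed_segment 0 p) (\<lambda>z. \<eta> (sgn p) (norm z) *\<^sub>R sgn p)"
      by (intro continuous_intros continuous_on_compose2[OF \<eta>(1)]) auto
    moreover have "\<eta> (sgn p) (norm z) *\<^sub>R sgn p = H z" if "z \<in> closed_segment 0 p" for z
      using that Hs unfolding closed_segment_0 by (auto simp: norm_sgn)
    ultimately show ?thesis by (simp cong: continuous_on_cong)
  qed
  have "continuous_on ?S H"
    using P(2) contp by (intro continuous_on_closed_Union) auto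
  moreover have "H ` ?S = ?R"
  proof -
    have "H ` closed_segment 0 p = closed_segment 0 (h p)" if p: "p \<in> P" for p
    proof -
      have "\<eta> (sgn p) ` {0..norm p} = {0..norm (h p)}"
      proof (intro equalityI subsetI)
        fix t assume "t \<in> {0..norm (h p)}"
        then show "t \<in> \<eta> (sgn p) ` {0..norm p}"
          using IVT'[of "\<eta> (sgn p)" 0 t "norm p"] \<eta>(2) \<eta>(4)[OF p] continuous_on_subset[OF \<eta>(1)]
          by fastforce
      next
        fix t assume "t \<in> \<eta> (sgn p) ` {0..norm p}"
        then obtain s where s: "0 \<le> s" "s \<le> norm p" "t = \<eta> (sgn p) s" by auto
        then show "t \<in> {0..norm (h p)}"
          using strict_mono_leD[OF \<eta>(3) s(1), of "sgn p"] strict_mono_leD[OF \<eta>(3) s(2), of "sgn p"]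
            \<eta>(2) \<eta>(4)[OF p] by auto
      qed
      then have "closed_segment 0 (h p) = (\<lambda>s. s *\<^sub>R sgn p) ` \<eta> (sgn p) ` {0..norm p}"
        using h(2) p by (simp add: closed_segment_0)
      also have "\<dots> = H ` closed_segment 0 p"
        unfolding closed_segment_0 image_image by (intro image_cong refl) (simp add: Hs)
      finally show ?thesis ..
    qed
    then show ?thesis using h(1) by (simp add: image_UN flip: h(1))
  qed
  moreover have "inj_on H ?S"
    by (intro inj_onI) (metis normH sgnH \<eta>(3) strict_mono_eq sgn_norm_eqI)
  moreover have "compact ?S" using P(2) by (intro compact_UN) auto
  ultimately obtain K where K: "homeomorphism ?S ?R H K"
    using homeomorphism_compact[of ?S H ?R] by blast
  moreover have "H x = h x" if "x \<in> P" for x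
    using that \<eta>(4) h(2) normH sgnH by (metis sgn_norm_eqI)
  moreover have "H ` (B \<inter> ?S) \<subseteq> B" if "B \<in> branches" for B
  proof -
    have "?R \<subseteq> triod" using Q closed_segment_0_subset_triod by blast
    then have "H z \<in> triod" if "z \<in> ?S" for z using \<open>H ` ?S = ?R\<close> that by blast
    moreover have "H z \<noteq> 0" if "z \<noteq> 0" for z
      using sgnH[of z] that by (metis sgn_zero_iff)
    ultimately show ?thesis using that sgnH unfolding branches_eq by auto
  qed
  ultimately show ?thesis by blast
qed

text \<open>Respecting the branches forces \<open>h\<close> to fix the centre; along each ray it is
  then an injective continuous function of the distance that starts at \<open>0\<close>, hence
  increasing.\<close>

lemma conjugation_of_homeomorphism:
  assumes P: "P \<subseteq> triod - {0}" "x \<in> P" "y \<in> P" "sgn x \<noteq> sgn y"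
    and h: "homeomorphism (\<Union>p\<in>P. closed_segment 0 p) S h k"
      "\<forall>B\<in>branches. h ` (B \<inter> (\<Union>p\<in>P. closed_segment 0 p)) \<subseteq> B"
  shows "p \<in> P \<Longrightarrow> sgn (h p) = sgn p"
    and "p \<in> P \<Longrightarrow> q \<in> P \<Longrightarrow> sgn p = sgn q \<Longrightarrow> norm p < norm q \<Longrightarrow> norm (h p) < norm (h q)"
proof -
  let ?S = "\<Union>p\<in>P. closed_segment 0 p"
  have cont: "continuous_on ?S h" and inj: "inj_on h ?S"
    using h(1) by (auto simp: homeomorphism_def intro: inj_on_inverseI)
  have br: "h z \<in> triod - {0} \<and> sgn (h z) = sgn z" if z: "z \<in> ?S" "z \<noteq> 0" for z
  proof -
    have zT: "z \<in> triod" using P(1) closed_segment_0_subset_triod z by blast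
    then have "{u \<in> triod - {0}. sgn u = sgn z} \<in> branches"
      using z(2) unfolding branches_eq by (auto simp: mem_triod_iff)
    then have "h ` ({u \<in> triod - {0}. sgn u = sgn z} \<inter> ?S) \<subseteq> {u \<in> triod - {0}. sgn u = sgn z}"
      using h(2) by (rule bspec[rotated])
    then show ?thesis using zT z by blast
  qed
  have P0: "p \<noteq> 0" if "p \<in> P" for p using that P(1) by auto
  have ray: "s *\<^sub>R sgn p \<in> ?S" if "p \<in> P" "0 \<le> s" "s \<le> norm p" for s p
    using that unfolding closed_segment_0 by (intro UN_I[of p] imageI) auto
  have hray: "h (s *\<^sub>R sgn p) = norm (h (s *\<^sub>R sgn p)) *\<^sub>R sgn p" if "p \<in> P" "0 < s" "s \<le> norm p" for s p
  proof -
    have "sgn (h (s *\<^sub>R sgn p)) = sgn p"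
      using br[OF ray[OF that(1), of s]] that P0 by (auto simp: sgn_scaleR sgn_sgn sgn_zero_iff)
    then show ?thesis using norm_scaleR_sgn by metis
  qed
  have contp: "continuous_on {0..norm p} (\<lambda>s. h (s *\<^sub>R sgn p))" if "p \<in> P" for p
    by (intro continuous_on_compose2[OF cont] continuous_intros) (use ray that in auto)
  \<comment> \<open>By continuity \<open>h 0\<close> lies in the closure of every branch that meets
    \<open>P\<close>. Two branches do, which leaves only \<open>h 0 = 0\<close>.\<close>
  have h0: "h 0 = norm (h 0) *\<^sub>R sgn p" if p: "p \<in> P" for p
  proof -
    define g where "g s = h (s *\<^sub>R sgn p) - norm (h (s *\<^sub>R sgn p)) *\<^sub>R sgn p" for s
    have cl: "closure {0<..<norm p} = {0..norm p}" using P0[OF p] by simp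
    have "continuous_on {0..norm p} g"
      unfolding g_def using contp[OF p] by (intro continuous_intros)
    moreover have "g s = 0" if "s \<in> {0<..<norm p}" for s
      unfolding g_def using hray[OF p, of s] that by simp
    ultimately have "g 0 = 0"
      using continuous_constant_on_closure[of "{0<..<norm p}" g 0 0] unfolding cl by simp
    then show ?thesis by (simp add: g_def)
  qed
  have "h 0 = 0"
  proof (rule ccontr)
    assume a: "h 0 \<noteq> 0"
    then have "sgn x = sgn y" using h0[OF P(2)] h0[OF P(3)] by (metis norm_eq_zero scaleR_cancel_left)
    then show False using P(4) by simp
  qed
  show "sgn (h p) = sgn p" if "p \<in> P"
    using br[of p] that P0 by auto
  show "norm (h p) < norm (h q)" if pq: "p \<in> P" "q \<in> P" "sgn p = sgn q" "norm p < norm q"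
  proof -
    let ?g = "\<lambda>s. norm (h (s *\<^sub>R sgn q))"
    have "inj_on ?g {0..norm q}"
    proof (rule inj_onI)
      fix s t assume st: "s \<in> {0..norm q}" "t \<in> {0..norm q}" "?g s = ?g t"
      have "h (s *\<^sub>R sgn q) = h (t *\<^sub>R sgn q)"
        using st hray[OF pq(2)] \<open>h 0 = 0\<close> by (metis atLeastAtMost_iff norm_eq_zero order_le_less scaleR_zero_left)
      then have "s *\<^sub>R sgn q = t *\<^sub>R sgn q"
        using inj ray[OF pq(2)] st by (auto dest: inj_onD)
      then show "s = t" using P0[OF pq(2)] by (auto simp: sgn_zero_iff)
    qed
    moreover have "continuous_on {0..norm q} ?g"
      by (intro continuous_intros contp pq)
    moreover have "0 < norm p" using P0[OF pq(1)] by simp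
    ultimately have "?g 0 < ?g (norm p) \<and> ?g (norm p) < ?g (norm q) \<or> ?g (norm q) < ?g (norm p) \<and> ?g (norm p) < ?g 0"
      using pq(4) by (intro continuous_inj_imp_mono)
    moreover have "\<not> ?g (norm p) < ?g 0" using \<open>h 0 = 0\<close> by simp
    ultimately have "?g (norm p) < ?g (norm q)" by blast
    then show ?thesis using pq(3) norm_scaleR_sgn by metis
  qed
qed

text \<open>Here the topology disappears from the notion of equivalence: a pattern amounts to the
  order of the points on the branches and the action of the map on them.\<close>

lemma cycle_equiv_iff:
  "((f, P), (g, Q)) \<in> cycle_equiv \<longleftrightarrow>
    (f, P) \<in> cycles \<and> (g, Q) \<in> cycles \<and> (\<exists>h. conjugation f P g Q h)"
proof (cases "(f, P) \<in> cycles \<and> (g, Q) \<in> cycles")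
  case True
  then interpret P: cycle f P + Q: cycle g Q by (simp_all add: cycle_def)
  have hull: "triod_hull P = (\<Union>p\<in>P. closed_segment 0 p)" "triod_hull Q = (\<Union>p\<in>Q. closed_segment 0 p)"
    using triod_hull_eq P.triod Q.triod P.two_branches Q.two_branches P.nonempty Q.nonempty by (metis ex_in_conv)+
  obtain x y where xy: "x \<in> P" "y \<in> P" "sgn x \<noteq> sgn y"
    using P.nonempty P.two_branches by (metis ex_in_conv)
  show ?thesis
  proof
    assume "((f, P), (g, Q)) \<in> cycle_equiv"
    then obtain h k where h: "homeomorphism (triod_hull P) (triod_hull Q) h k" "h ` P = Q"
      "\<forall>x\<in>P. h (f x) = g (h x)" "\<forall>B\<in>branches. h ` (B \<inter> triod_hull P) \<subseteq> B"
      unfolding cycle_equiv_def by auto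
    have "conjugation f P g Q h"
      using conjugation_of_homeomorphism[OF P.triod xy h(1,4)[unfolded hull(1)]] h(2,3)
      unfolding conjugation_def by blast
    then show "(f, P) \<in> cycles \<and> (g, Q) \<in> cycles \<and> (\<exists>h. conjugation f P g Q h)" using True by blast
  next
    assume "(f, P) \<in> cycles \<and> (g, Q) \<in> cycles \<and> (\<exists>h. conjugation f P g Q h)"
    then obtain h where h: "conjugation f P g Q h" by blast
    obtain H K where H: "homeomorphism (triod_hull P) (triod_hull Q) H K" "\<forall>x\<in>P. H x = h x"
      "\<forall>B\<in>branches. H ` (B \<inter> triod_hull P) \<subseteq> B"
      using homeomorphism_of_conjugation[OF P.triod P.finite Q.triod, of h] h
      unfolding hull conjugation_def by blast
    have "H ` P = Q" "\<forall>x\<in>P. H (f x) = g (H x)"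
      using h H(2) P.map_mem by (auto simp: conjugation_def)
    then show "((f, P), (g, Q)) \<in> cycle_equiv"
      using True H unfolding cycle_equiv_def by blast
  qed
qed (auto simp: cycle_equiv_def)

section \<open>Patterns as equivalence classes\<close>

lemma equiv_cycle_equiv: "equiv cycles cycle_equiv"
proof (rule equivI)
  show "cycle_equiv \<subseteq> cycles \<times> cycles" by (auto simp: cycle_equiv_def)
  show "refl_on cycles cycle_equiv"
    by (intro refl_onI) (auto simp: cycle_equiv_iff intro!: exI[of _ id] conjugation_refl)
  show "sym cycle_equiv"
  proof (rule symI, clarify)
    fix f P g Q assume "((f, P), (g, Q)) \<in> cycle_equiv"
    then show "((g, Q), (f, P)) \<in> cycle_equiv"
      using conjugation_sym cycle.image_eq unfolding cycle_equiv_iff cycle_def by blast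
  qed
  show "trans cycle_equiv"
    by (rule transI, clarify) (metis conjugation_trans cycle_equiv_iff)
qed

lemma pattern_eq_pattern_of:
  assumes "A \<in> patterns" "(f, P) \<in> A"
  shows "(f, P) \<in> cycles \<and> A = pattern_of f P"
proof -
  obtain c where c: "c \<in> cycles" "A = cycle_equiv `` {c}"
    using assms(1) unfolding patterns_def by (rule quotientE)
  then have r: "(c, (f, P)) \<in> cycle_equiv" using assms(2) by simp
  then have "cycle_equiv `` {c} = cycle_equiv `` {(f, P)}"
    by (rule equiv_class_eq[OF equiv_cycle_equiv])
  moreover have "(f, P) \<in> cycles" using r equiv_type[OF equiv_cycle_equiv] by blast
  ultimately show ?thesis using c(2) by (simp add: pattern_of_def)
qed

lemma mem_pattern_of_iff:
  "(g, Q) \<in> pattern_of f P \<longleftrightarrow> (f, P) \<in> cycles \<and> (g, Q) \<in> cycles \<and> (\<exists>h. conjugation f P g Q h)"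
  by (simp add: pattern_of_def cycle_equiv_iff)

lemma pattern_of_mem_patterns: "(f, P) \<in> cycles \<Longrightarrow> pattern_of f P \<in> patterns"
  unfolding patterns_def pattern_of_def by (rule quotientI)

lemma mem_pattern_of_self: "(f, P) \<in> cycles \<Longrightarrow> (f, P) \<in> pattern_of f P"
  using conjugation_refl by (auto simp: mem_pattern_of_iff)

section \<open>Colours and rotation numbers\<close>

lemma branch_index_props:
  assumes "numbering b" "u \<in> triod - {0}"
  shows "branch_index b u < 3 \<and> u \<in> b (branch_index b u)"
proof -
  have bij: "bij_betw b {..<3} branches" using assms(1) by (simp add: numbering_def)
  have "{z \<in> triod - {0}. sgn z = sgn u} \<in> branches"
    using assms(2) unfolding branches_eq by (auto simp: mem_triod_iff)
  then obtain i where i: "i < 3" "b i = {z \<in> triod - {0}. sgn z = sgn u}"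
    using bij unfolding bij_betw_def by (metis (no_types, lifting) imageE lessThan_iff)
  show ?thesis
    unfolding branch_index_def
  proof (rule theI[of _ i])
    show "i < 3 \<and> u \<in> b i" using i assms(2) by auto
    fix j assume j: "j < 3 \<and> u \<in> b j"
    then have "b j \<in> branches" using bij unfolding bij_betw_def by auto
    then obtain w where "b j = {z \<in> triod - {0}. sgn z = w}" unfolding branches_eq by blast
    then have "b j = b i" using j i by simp
    then show "j = i" using bij j i unfolding bij_betw_def inj_on_def by auto
  qed
qed

lemma numbering_sgn_eq_iff:
  assumes "numbering b" "i < 3" "u \<in> b i"
  shows "v \<in> b i \<longleftrightarrow> v \<in> triod - {0} \<and> sgn v = sgn u"
proof -
  have "b i \<in> branches" using assms(1,2) by (auto simp: numbering_def bij_betw_def)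
  then obtain w where "b i = {z \<in> triod - {0}. sgn z = w}" unfolding branches_eq by blast
  then show ?thesis using assms(3) by simp
qed

lemma branch_index_eq_iff:
  assumes "numbering b" "u \<in> triod - {0}" "v \<in> triod - {0}"
  shows "branch_index b u = branch_index b v \<longleftrightarrow> sgn u = sgn v"
proof
  assume "branch_index b u = branch_index b v"
  then show "sgn u = sgn v"
    using branch_index_props[OF assms(1,2)] branch_index_props[OF assms(1,3)]
      numbering_sgn_eq_iff[OF assms(1)] by metis
next
  assume "sgn u = sgn v"
  then have "v \<in> b i \<longleftrightarrow> u \<in> b i" if "i < 3" for i
    using numbering_sgn_eq_iff[OF assms(1) that] assms(2,3) by metis
  then show "branch_index b u = branch_index b v"
    unfolding branch_index_def by metis
qed

text \<open>Three times the displacement: \<open>0\<close>, \<open>1\<close>, \<open>2\<close> stand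
  for green, black and red. Integer values keep the later balancing of weights exact.\<close>

definition colour :: "(nat \<Rightarrow> complex set) \<Rightarrow> (complex \<Rightarrow> complex) \<Rightarrow> complex \<Rightarrow> int" where
  "colour b f x = (int (branch_index b (f x)) - int (branch_index b x)) mod 3"

lemma disp_eq_colour: "disp b x (f x) = of_int (colour b f x) / 3"
  by (simp add: disp_def colour_def)

lemma black_iff: "black b f x \<longleftrightarrow> colour b f x = 1"
  by (auto simp: black_def disp_eq_colour)

lemma colour_cong:
  assumes "numbering b" "x \<in> triod - {0}" "f x \<in> triod - {0}" "y \<in> triod - {0}" "g y \<in> triod - {0}"
    and "sgn x = sgn y" "sgn (f x) = sgn (g y)"
  shows "colour b f x = colour b g y"
  using branch_index_eq_iff[OF assms(1,2,4)] branch_index_eq_iff[OF assms(1,3,5)] assms(6,7)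
  by (simp add: colour_def)

lemma total_disp_eq_colour: "total_disp b f x k = of_int (\<Sum>j<k. colour b f ((f ^^ j) x)) / 3"
  by (simp add: total_disp_def disp_eq_colour sum_divide_distrib)

text \<open>Differences of branch indices telescope, so the fractional part of the total
  displacement depends only on the two end branches.\<close>

lemma sum_colour_mod:
  "(\<Sum>j<k. colour b f ((f ^^ j) x)) mod 3 = (int (branch_index b ((f ^^ k) x)) - int (branch_index b x)) mod 3"
proof (induction k)
  case (Suc k)
  have "(\<Sum>j<Suc k. colour b f ((f ^^ j) x)) mod 3 =
      ((\<Sum>j<k. colour b f ((f ^^ j) x)) mod 3 + colour b f ((f ^^ k) x)) mod 3"
    by (simp add: mod_add_left_eq)
  also have "\<dots> = (int (branch_index b ((f ^^ Suc k) x)) - int (branch_index b x)) mod 3"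
    unfolding Suc.IH by (simp add: colour_def mod_simps)
  finally show ?case .
qed simp

lemma sum_lessThan_add:
  fixes k m :: nat
  shows "(\<Sum>j<m + k. g j) = (\<Sum>j<m. g j) + (\<Sum>j<k. g (m + j) :: 'a :: comm_monoid_add)"
  by (induction k) (auto simp: add.assoc)

section \<open>Winding, weights and potentials\<close>

context cycle
begin

text \<open>Three times the first entry of the rotation pair.\<close>

definition wind :: "(nat \<Rightarrow> complex set) \<Rightarrow> int" where
  "wind b = (\<Sum>x\<in>P. colour b f x)"

lemma sum_colour_period: "x \<in> P \<Longrightarrow> (\<Sum>j<card P. colour b f ((f ^^ j) x)) = wind b"
  unfolding wind_def using orbit[of x] by (intro sum.reindex_bij_betw) auto

lemma rotation_number_eq: "rotation_number b f P = of_int (wind b) / (3 * real (card P))"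
proof -
  have "(SOME x. x \<in> P) \<in> P" using nonempty by (simp add: some_in_eq)
  then show ?thesis
    using sum_colour_period[of _ b] by (simp add: rotation_number_def rotation_pair_def total_disp_eq_colour)
qed

text \<open>The excess of one displacement over the rotation number of \<open>P\<close>, multiplied
  by \<open>3 * card P\<close> to make it an integer. A loop has the rotation number of
  \<open>P\<close> as its average displacement exactly when its weights sum to
  \<open>0\<close>.\<close>

definition weight :: "(nat \<Rightarrow> complex set) \<Rightarrow> complex \<Rightarrow> int" where
  "weight b x = int (card P) * colour b f x - wind b"

lemma sum_weight_orbit:
  "(\<Sum>j<k. weight b ((f ^^ j) x)) = int (card P) * (\<Sum>j<k. colour b f ((f ^^ j) x)) - int k * wind b"
  by (induction k) (auto simp: weight_def algebra_simps)

lemma sum_weight_return: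
  assumes "x \<in> P" "(f ^^ M) x = x"
  shows "(\<Sum>j<M. weight b ((f ^^ j) x)) = 0"
proof -
  have "(\<Sum>j<card P * l. weight b ((f ^^ j) x)) = 0" for l
  proof (induction l)
    case (Suc l)
    have "(f ^^ (card P * l + j)) x = (f ^^ j) x" for j
    proof -
      have "(f ^^ (card P * l)) x = x"
        using funpow_mod_eq[of "card P" f x "card P * l"] orbit[OF assms(1)] by simp
      then show ?thesis by (metis add.commute funpow_add o_apply)
    qed
    then have "(\<Sum>j<card P * l + card P. weight b ((f ^^ j) x)) = (\<Sum>j<card P. weight b ((f ^^ j) x))"
      by (simp only: sum_lessThan_add Suc.IH)
    also have "\<dots> = 0" using sum_colour_period[OF assms(1), of b] by (simp add: sum_weight_orbit)
    finally show ?case by (simp add: add.commute)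
  qed simp
  then show ?thesis using return_dvd[OF assms] by (auto elim: dvdE)
qed

text \<open>The code function without the integer part: subtracting the true displacement gives a
  rule that holds at each step and needs no starting point.\<close>

definition potential :: "(nat \<Rightarrow> complex set) \<Rightarrow> (complex \<Rightarrow> real) \<Rightarrow> bool" where
  "potential b \<Psi> \<longleftrightarrow> (\<forall>x\<in>P. \<Psi> (f x) = \<Psi> x + rotation_number b f P - of_int (colour b f x) / 3)"

lemma potential_funpow:
  assumes "potential b \<Psi>" "x \<in> P"
  shows "\<Psi> ((f ^^ k) x) = \<Psi> x + real k * rotation_number b f P - of_int (\<Sum>j<k. colour b f ((f ^^ j) x)) / 3"
proof (induction k)
  case (Suc k)
  have "\<Psi> (f ((f ^^ k) x)) = \<Psi> ((f ^^ k) x) + rotation_number b f P - of_int (colour b f ((f ^^ k) x)) / 3"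
    using assms(1) funpow_mem[OF assms(2)] by (simp add: potential_def)
  then show ?case using Suc by (simp add: algebra_simps add_divide_distrib)
qed simp

text \<open>This turns a failure of monotonicity between two points of a branch into a sign
  condition on the weight of the orbit segment joining them.\<close>

lemma potential_weight:
  assumes "potential b \<Psi>" "x \<in> P"
  shows "\<Psi> ((f ^^ k) x) - \<Psi> x = - of_int (\<Sum>j<k. weight b ((f ^^ j) x)) / (3 * real (card P))"
  unfolding potential_funpow[OF assms] sum_weight_orbit rotation_number_eq
  using card_pos by (simp add: field_simps)

text \<open>The recursion determines the values along the orbit of \<open>x0\<close>; it closes up
  because the colours of a full period sum to \<open>wind b\<close>.\<close>

lemma potential_exists: "\<exists>\<Psi>. potential b \<Psi>"
proof -
  obtain x0 where x0: "x0 \<in> P" using nonempty by blast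
  note o = orbit[OF x0]
  define \<rho> where "\<rho> = rotation_number b f P"
  define g where "g k = real k * \<rho> - of_int (\<Sum>j<k. colour b f ((f ^^ j) x0)) / 3" for k
  define ix where "ix = inv_into {..<card P} (\<lambda>k. (f ^^ k) x0)"
  have ix: "ix ((f ^^ k) x0) = k" if "k < card P" for k
    unfolding ix_def using o that by (intro inv_into_f_f) (auto simp: bij_betw_def)
  have "g (ix (f x)) = g (ix x) + \<rho> - of_int (colour b f x) / 3" if "x \<in> P" for x
  proof -
    obtain k where k: "k < card P" "x = (f ^^ k) x0" using o \<open>x \<in> P\<close> by (auto simp: bij_betw_def)
    have s: "g (Suc k) = g k + \<rho> - of_int (colour b f x) / 3"
      by (simp add: g_def k(2) algebra_simps add_divide_distrib)
    show ?thesis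
    proof (cases "Suc k < card P")
      case True
      then show ?thesis using s ix[OF True] ix[OF k(1)] k(2) by simp
    next
      case False
      then have e: "Suc k = card P" using k(1) by simp
      then have "f x = (f ^^ 0) x0" using o k(2) by (metis funpow.simps(2) funpow_0 o_apply)
      then have "ix (f x) = 0" using ix[of 0] card_pos by simp
      moreover have "g (Suc k) = 0"
        using sum_colour_period[OF x0, of b] card_pos unfolding e g_def \<rho>_def rotation_number_eq by simp
      moreover have "ix x = k" using ix[OF k(1)] k(2) by simp
      moreover have "g 0 = 0" by (simp add: g_def)
      ultimately show ?thesis using s by simp
    qed
  qed
  then show ?thesis unfolding potential_def \<rho>_def by (intro exI[of _ "g \<circ> ix"]) simp
qed

text \<open>Code functions are potentials up to a correction that is constant on each branch.\<close>

lemma code_function_of_potential: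
  assumes "potential b \<Psi>" "x0 \<in> P"
  shows "code_function b f P
    (\<lambda>x. \<Psi> x - \<Psi> x0 + of_int ((int (branch_index b x) - int (branch_index b x0)) mod 3) / 3)"
    (is "code_function b f P ?\<psi>")
  unfolding code_function_def
proof (intro bexI[of _ x0] conjI allI assms(2))
  fix k
  let ?S = "\<Sum>j<k. colour b f ((f ^^ j) x0)"
  \<comment> \<open>The floor is the quotient of \<open>?S\<close> by 3; the remainder is the branch
    correction in \<open>?\<psi>\<close>.\<close>
  have "\<lfloor>total_disp b f x0 k\<rfloor> = ?S div 3"
    unfolding total_disp_eq_colour using floor_divide_of_int_eq[of ?S 3] by simp
  moreover have "real_of_int ?S = 3 * of_int (?S div 3) + of_int (?S mod 3)"
    using arg_cong[OF mult_div_mod_eq[of 3 ?S, symmetric], of real_of_int] by (simp only: of_int_add of_int_mult of_int_numeral)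
  ultimately show "?\<psi> ((f ^^ k) x0) =
      ?\<psi> x0 + real k * rotation_number b f P - real_of_int \<lfloor>total_disp b f x0 k\<rfloor>"
    using potential_funpow[OF assms, of k] sum_colour_mod[of b f x0 k] by (simp add: field_simps)
qed simp

lemma potential_of_code_function:
  assumes "code_function b f P \<psi>"
  obtains x0 where "potential b (\<lambda>x. \<psi> x - of_int ((int (branch_index b x) - int (branch_index b x0)) mod 3) / 3)"
proof -
  obtain x0 where x0: "x0 \<in> P" "\<psi> x0 = 0" and
    \<psi>: "\<And>k. \<psi> ((f ^^ k) x0) = \<psi> x0 + real k * rotation_number b f P - real_of_int \<lfloor>total_disp b f x0 k\<rfloor>"
    using assms unfolding code_function_def by blast
  define \<Psi> where "\<Psi> x = \<psi> x - of_int ((int (branch_index b x) - int (branch_index b x0)) mod 3) / 3" for x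
  have \<Psi>: "\<Psi> ((f ^^ k) x0) = real k * rotation_number b f P - of_int (\<Sum>j<k. colour b f ((f ^^ j) x0)) / 3" for k
  proof -
    let ?S = "\<Sum>j<k. colour b f ((f ^^ j) x0)"
    have "\<lfloor>total_disp b f x0 k\<rfloor> = ?S div 3"
      unfolding total_disp_eq_colour using floor_divide_of_int_eq[of ?S 3] by simp
    moreover have "real_of_int ?S = 3 * of_int (?S div 3) + of_int (?S mod 3)"
      using arg_cong[OF mult_div_mod_eq[of 3 ?S, symmetric], of real_of_int] by (simp only: of_int_add of_int_mult of_int_numeral)
    ultimately show ?thesis
      using \<psi>[of k] x0(2) sum_colour_mod[of b f x0 k] by (simp add: \<Psi>_def field_simps)
  qed
  have "potential b \<Psi>"
    unfolding potential_def
  proof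
    fix x assume "x \<in> P"
    then obtain k where k: "x = (f ^^ k) x0" using reach[OF x0(1)] by blast
    show "\<Psi> (f x) = \<Psi> x + rotation_number b f P - of_int (colour b f x) / 3"
      using \<Psi>[of k] \<Psi>[of "Suc k"] by (simp add: k algebra_simps add_divide_distrib)
  qed
  then show ?thesis using that unfolding \<Psi>_def by blast
qed

end

section \<open>Invariance under conjugation\<close>

lemma colour_conjugation:
  assumes "cycle f P" "cycle g Q" "numbering b" "conjugation f P g Q h" "x \<in> P"
  shows "colour b g (h x) = colour b f x"
proof -
  interpret P: cycle f P by fact
  interpret Q: cycle g Q by fact
  have "h x \<in> Q" "f x \<in> P" "sgn (h x) = sgn x" "sgn (h (f x)) = sgn (f x)" "g (h x) = h (f x)"
    using conjugationD[OF assms(4,5)] P.map_mem[OF assms(5)] conjugationD(3)[OF assms(4) P.map_mem[OF assms(5)]]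
    by simp_all
  then show ?thesis
    using assms(3,5) P.triod Q.triod Q.map_mem[of "h x"] by (intro colour_cong) auto
qed

lemma rotation_number_conjugation:
  assumes "cycle f P" "cycle g Q" "numbering b" "conjugation f P g Q h"
  shows "rotation_number b g Q = rotation_number b f P"
proof -
  have "bij_betw h P Q"
    using conjugation_inj[OF assms(4)] assms(4) by (simp add: bij_betw_def conjugation_def)
  then have "card Q = card P" "(\<Sum>x\<in>P. colour b g (h x)) = (\<Sum>y\<in>Q. colour b g y)"
    using bij_betw_same_card sum.reindex_bij_betw by fastforce+
  then show ?thesis
    using colour_conjugation[OF assms]
    by (simp add: cycle.rotation_number_eq[OF assms(1)] cycle.rotation_number_eq[OF assms(2)]
        cycle.wind_def[OF assms(1)] cycle.wind_def[OF assms(2)])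
qed

lemma pattern_rotation_number_eq:
  assumes "A \<in> patterns" "(f, P) \<in> A" "numbering b"
  shows "pattern_rotation_number b A = rotation_number b f P"
proof -
  have r: "rotation_number b g Q = rotation_number b f P" if "(g, Q) \<in> A" for g Q
  proof -
    have "A = pattern_of f P" using pattern_eq_pattern_of assms by blast
    then show ?thesis
      using that by (auto simp: mem_pattern_of_iff cycle_def intro: rotation_number_conjugation[OF _ _ assms(3)])
  qed
  show ?thesis
    unfolding pattern_rotation_number_def
  proof (rule the_equality)
    fix r assume "\<forall>(f, P)\<in>A. rotation_number b f P = r"
    then show "r = rotation_number b f P" using assms(2) by auto
  qed (use r in auto)
qed

section \<open>Maps that vanish away from the cycle\<close>

lemma finite_separated:
  fixes S :: "'a :: metric_space set"
  assumes "finite S"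
  shows "\<exists>d>0. \<forall>x\<in>S. \<forall>y\<in>S. x \<noteq> y \<longrightarrow> d \<le> dist x y"
proof -
  define D where "D = insert 1 ((\<lambda>(x, y). dist x y) ` {(x, y). x \<in> S \<and> y \<in> S \<and> x \<noteq> y})"
  have "finite {(x, y). x \<in> S \<and> y \<in> S \<and> x \<noteq> y}"
    by (rule finite_subset[of _ "S \<times> S"]) (use assms in auto)
  then have D: "finite D" "D \<noteq> {}" unfolding D_def by auto
  have "\<forall>t\<in>D. 0 < t" by (auto simp: D_def)
  then have "0 < Min D" using D by simp
  moreover have "Min D \<le> dist x y" if "x \<in> S" "y \<in> S" "x \<noteq> y" for x y
    using that D by (intro Min_le) (auto simp: D_def)
  ultimately show ?thesis by blast
qed

lemma dist_same_branch:
  assumes "x \<in> triod - {0}" "y \<in> triod - {0}" "sgn x = sgn y"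
  shows "dist x y = \<bar>norm x - norm y\<bar>"
proof -
  have "x = norm x *\<^sub>R sgn x" "y = norm y *\<^sub>R sgn x"
    using assms norm_scaleR_sgn[of x] norm_scaleR_sgn[of y] by simp_all
  then have "x - y = (norm x - norm y) *\<^sub>R sgn x" by (simp add: scaleR_diff_left flip: norm_scaleR_sgn)
  then show ?thesis using assms(1) by (simp add: dist_norm norm_sgn)
qed

context cycle
begin

lemma inward: "x \<in> P \<Longrightarrow> sgn (f x) = sgn x \<Longrightarrow> norm (f x) < norm x"
  using triod by (intro green_moves_inward map) auto

text \<open>The bump functions make \<open>F\<close> expand towards \<open>0\<close> around each point of \<open>P\<close>, so that a cycle of
  \<open>F\<close> is a pseudo-orbit of \<open>P\<close> all of whose jumps go inwards. The potential forbids such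
  jumps when the rotation numbers agree, and expansion then forces the cycle to be \<open>P\<close>.\<close>

lemma rigid_map_exists:
  assumes b: "numbering b" and pot: "potential b \<Psi>"
    and strict: "\<And>x y. \<lbrakk>x \<in> P; y \<in> P; sgn x = sgn y; norm x < norm y\<rbrakk> \<Longrightarrow> \<sigma> * \<Psi> x < \<sigma> * \<Psi> y"
  shows "\<exists>F\<in>triod_maps. (\<forall>p\<in>P. F p = f p) \<and>
    (\<forall>Q. (F, Q) \<in> cycles \<and> rotation_number b F Q = rotation_number b f P \<longrightarrow> Q = P)"
proof -
  \<comment> \<open>Including \<open>0\<close> in the separated set keeps the bumps away from the
    branching point as well as from each other.\<close>
  obtain \<delta> where \<delta>: "0 < \<delta>" "\<And>x y. x \<in> insert 0 P \<Longrightarrow> y \<in> insert 0 P \<Longrightarrow> x \<noteq> y \<Longrightarrow> \<delta> \<le> dist x y"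
    using finite_separated[of "insert 0 P"] finite by blast
  define \<epsilon> where "\<epsilon> = \<delta> / 2"
  have \<epsilon>: "0 < \<epsilon>" using \<delta>(1) by (simp add: \<epsilon>_def)
  have sep: "2 * \<epsilon> \<le> dist x y" if "x \<in> P" "y \<in> P" "x \<noteq> y" for x y
    using \<delta>(2)[of x y] that by (simp add: \<epsilon>_def)
  have sep0: "2 * \<epsilon> \<le> norm x" if "x \<in> P" for x
    using \<delta>(2)[of x 0] that triod by (auto simp: \<epsilon>_def)
  have sep_norm: "2 * \<epsilon> \<le> norm x - norm y" if "x \<in> P" "y \<in> P" "sgn x = sgn y" "norm y < norm x" for x y
  proof -
    have "x \<in> triod - {0}" "y \<in> triod - {0}" using that triod by auto
    then show ?thesis using sep[OF that(1,2)] that(3,4) dist_same_branch[of x y] by auto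
  qed
  \<comment> \<open>A sum of disjoint tents: near \<open>p\<close> the values run along the segment
    from \<open>f p\<close> towards \<open>0\<close>, and far from \<open>P\<close> they are
    \<open>0\<close>.\<close>
  define F where "F z = (\<Sum>p\<in>P. max 0 (1 - dist z p / \<epsilon>) *\<^sub>R f p)" for z
  have F: "F z = (1 - dist z p / \<epsilon>) *\<^sub>R f p" if p: "p \<in> P" "dist z p < \<epsilon>" for z p
  proof -
    have "max 0 (1 - dist z q / \<epsilon>) = 0" if "q \<in> P - {p}" for q
    proof -
      have "2 * \<epsilon> \<le> dist p q" using sep[of p q] that p by auto
      then have "\<epsilon> \<le> dist z q" using p(2) dist_triangle3[of p q z] by linarith
      then show ?thesis using \<epsilon> by simp
    qed
    then have "(\<Sum>q\<in>P - {p}. max 0 (1 - dist z q / \<epsilon>) *\<^sub>R f q) = 0" by (intro sum.neutral) simp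
    then have "F z = max 0 (1 - dist z p / \<epsilon>) *\<^sub>R f p"
      unfolding F_def using sum.remove[OF finite p(1), of "\<lambda>q. max 0 (1 - dist z q / \<epsilon>) *\<^sub>R f q"] by simp
    then show ?thesis using p(2) \<epsilon> by (simp add: max_def)
  qed
  have F_far: "F z = 0" if "\<And>p. p \<in> P \<Longrightarrow> \<epsilon> \<le> dist z p" for z
    unfolding F_def
  proof (intro sum.neutral ballI)
    fix p assume "p \<in> P"
    then have "max 0 (1 - dist z p / \<epsilon>) = 0" using that[of p] \<epsilon> by simp
    then show "max 0 (1 - dist z p / \<epsilon>) *\<^sub>R f p = 0" by simp
  qed
  have near: "z \<noteq> 0 \<and> sgn z = sgn p \<and> dist z p = \<bar>norm z - norm p\<bar>"
    if z: "z \<in> triod" "p \<in> P" "dist z p < \<epsilon>" for z p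
  proof -
    have w: "sgn p ^ 3 = 1" using sgn_cube z by blast
    have "inner (sgn p) p = norm p" using inner_triod[OF w, of p] triod z(2) by auto
    moreover have "\<bar>inner (sgn p) z - inner (sgn p) p\<bar> \<le> dist z p"
      using Cauchy_Schwarz_ineq2[of "sgn p" "z - p"] cube_root_norm[OF w]
      by (simp add: inner_diff_right dist_norm)
    ultimately have pos: "0 < inner (sgn p) z" using sep0[OF z(2)] z(3) \<epsilon> by linarith
    then have "z = inner (sgn p) z *\<^sub>R sgn p" by (rule inner_triod_pos[OF w z(1)])
    then have "sgn z = sgn p" using pos w by (metis sgn_scale_cube_root)
    moreover have "z \<noteq> 0" using pos by auto
    ultimately show ?thesis using dist_same_branch[of z p] z triod by auto
  qed
  have F0: "F 0 = 0"
  proof (rule F_far)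
    fix p assume "p \<in> P"
    then show "\<epsilon> \<le> dist 0 p" using sep0[of p] \<epsilon> by simp
  qed
  have FP: "F p = f p" if "p \<in> P" for p using F[OF that, of p] \<epsilon> by simp
  have F_triod: "F z \<in> triod" for z
  proof (cases "\<exists>p\<in>P. dist z p < \<epsilon>")
    case True
    then obtain p where p: "p \<in> P" "dist z p < \<epsilon>" by blast
    then show ?thesis
      unfolding F[OF p] using \<epsilon> map_mem triod by (intro triod_scaleR) auto
  next
    case False
    then show ?thesis using F_far[of z] by (auto simp: mem_triod_iff linorder_not_less)
  qed
  \<comment> \<open>A fixed point near \<open>p\<close> would make \<open>p\<close> green; then
    \<open>f p\<close> is at least \<open>2 * \<epsilon>\<close> closer to \<open>0\<close> than
    \<open>p\<close>, whereas the fixed point is within \<open>\<epsilon>\<close> of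
    \<open>p\<close> and no farther out than \<open>f p\<close>.\<close>
  have "z = 0" if z: "z \<in> triod" "F z = z" for z
  proof (rule ccontr)
    assume "z \<noteq> 0"
    then obtain p where p: "p \<in> P" "dist z p < \<epsilon>" using z(2) F_far by (metis linorder_not_less)
    have c: "0 < 1 - dist z p / \<epsilon>" "1 - dist z p / \<epsilon> \<le> 1" using p(2) \<epsilon> by auto
    have "sgn z = sgn (f p)" using F[OF p] c(1) z(2) by (metis sgn_scaleR sgn_pos scaleR_one)
    then have s: "sgn (f p) = sgn p" using near[OF z(1) p] by simp
    have "norm z \<le> norm (f p)"
      using F[OF p] c z(2) by (metis abs_of_pos mult_left_le_one_le norm_ge_zero norm_scaleR less_imp_le)
    moreover have "2 * \<epsilon> \<le> norm p - norm (f p)"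
      using inward[OF p(1) s] sep_norm[of p "f p"] s p(1) map_mem by auto
    ultimately show False using near[OF z(1) p] p(2) \<epsilon> by linarith
  qed
  moreover have "continuous_on triod F" unfolding F_def using \<epsilon> by (intro continuous_intros) auto
  ultimately have FU: "F \<in> triod_maps" using F0 F_triod by (auto simp: triod_maps_def)
  have "Q = P" if Q: "(F, Q) \<in> cycles" "rotation_number b F Q = rotation_number b f P" for Q
  proof -
    interpret Q: cycle F Q using Q(1) by (simp add: cycle_def)
    have "\<exists>p\<in>P. dist q p < \<epsilon>" if "q \<in> Q" for q
      using F_far[of q] Q.map_mem[OF that] Q.triod by force
    then obtain X where X: "\<And>q. q \<in> Q \<Longrightarrow> X q \<in> P \<and> dist q (X q) < \<epsilon>" by metis
    have Xs: "sgn (X q) = sgn q" "dist q (X q) = \<bar>norm q - norm (X q)\<bar>" if "q \<in> Q" for q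
      using near[of q "X q"] X[OF that] Q.triod that by auto
    have FX: "F q = (1 - dist q (X q) / \<epsilon>) *\<^sub>R f (X q)" if "q \<in> Q" for q using F X that by blast
    have c: "0 < 1 - dist q (X q) / \<epsilon>" "1 - dist q (X q) / \<epsilon> \<le> 1" if "q \<in> Q" for q
      using X[OF that] \<epsilon> by auto
    have sF: "sgn (F q) = sgn (f (X q))" if "q \<in> Q" for q
      using FX[OF that] c(1)[OF that] by (simp add: sgn_scaleR)
    have sX: "sgn (X (F q)) = sgn (f (X q))" if "q \<in> Q" for q
      using sF Xs(1) Q.map_mem that by simp
    \<comment> \<open>Companions jump only inwards: \<open>F\<close> shortens images, and points of
      \<open>P\<close> on one branch are too far apart for an error below \<open>\<epsilon>\<close>
      to reach the next one outwards.\<close>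
    have le: "norm (X (F q)) \<le> norm (f (X q))" if q: "q \<in> Q" for q
    proof (rule ccontr)
      assume "\<not> ?thesis"
      then have "2 * \<epsilon> \<le> norm (X (F q)) - norm (f (X q))"
        using sep_norm[of "X (F q)" "f (X q)"] X[OF q] X[OF Q.map_mem[OF q]] map_mem sX[OF q] by auto
      moreover have "norm (F q) \<le> norm (f (X q))"
        unfolding FX[OF q] using c[OF q] by (simp add: mult_left_le_one_le)
      moreover have "\<bar>norm (F q) - norm (X (F q))\<bar> < \<epsilon>"
        using Xs(2)[OF Q.map_mem[OF q]] X[OF Q.map_mem[OF q]] by simp
      ultimately show False using \<epsilon> by linarith
    qed
    have col: "colour b F q = colour b f (X q)" if q: "q \<in> Q" for q
      using q X[OF q] Q.triod triod Q.map_mem[OF q] map_mem[of "X q"] sF[OF q] Xs(1)[OF q]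
      by (intro colour_cong[OF b]) auto
    \<comment> \<open>The signed loss of potential in the jump from \<open>f (X q)\<close> to
      \<open>X (F q)\<close>, nonnegative by strictness and \<open>0\<close> only without a jump.
      Over the cycle \<open>Q\<close> the losses sum to \<open>0\<close> because the rotation
      numbers agree.\<close>
    define J where "J q = \<sigma> * \<Psi> (f (X q)) - \<sigma> * \<Psi> (X (F q))" for q
    have J: "0 \<le> J q \<and> (J q = 0 \<longrightarrow> X (F q) = f (X q))" if q: "q \<in> Q" for q
    proof (cases "norm (X (F q)) = norm (f (X q))")
      case True
      then have "X (F q) = f (X q)" using sX[OF q] sgn_norm_eqI by blast
      then show ?thesis by (simp add: J_def)
    next
      case False
      then show ?thesis
        using le[OF q] sX[OF q] strict[of "X (F q)" "f (X q)"] X[OF q] X[OF Q.map_mem[OF q]] map_mem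
        by (force simp: J_def)
    qed
    have "(\<Sum>q\<in>Q. \<Psi> (f (X q))) = (\<Sum>q\<in>Q. \<Psi> (X q) + rotation_number b f P - of_int (colour b F q) / 3)"
      using pot X col by (intro sum.cong refl) (simp add: potential_def)
    also have "\<dots> = (\<Sum>q\<in>Q. \<Psi> (X q)) + (real (card Q) * rotation_number b F Q - of_int (Q.wind b) / 3)"
      using Q(2) by (simp add: sum.distrib sum_subtractf Q.wind_def sum_divide_distrib)
    also have "real (card Q) * rotation_number b F Q - of_int (Q.wind b) / 3 = 0"
      using Q.card_pos by (simp add: Q.rotation_number_eq)
    also have "(\<Sum>q\<in>Q. \<Psi> (X q)) = (\<Sum>q\<in>Q. \<Psi> (X (F q)))"
      using sum.reindex[OF Q.inj, of "\<lambda>q. \<Psi> (X q)"] Q.image_eq by simp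
    finally have "(\<Sum>q\<in>Q. J q) = 0"
      unfolding J_def by (simp add: sum_subtractf flip: sum_distrib_left)
    then have XF: "X (F q) = f (X q)" if "q \<in> Q" for q
      using sum_nonneg_eq_0_iff[OF Q.finite, of J] J that by blast
    \<comment> \<open>\<open>f (X q)\<close> has norm at least \<open>2 * \<epsilon>\<close>, so the
      tent at \<open>X q\<close> stretches distances at least twofold.\<close>
    have exp: "2 * dist q (X q) \<le> dist (F q) (X (F q))" if q: "q \<in> Q" for q
    proof -
      have "dist (F q) (X (F q)) = norm ((dist q (X q) / \<epsilon>) *\<^sub>R f (X q))"
      proof -
        have "F q - f (X q) = - ((dist q (X q) / \<epsilon>) *\<^sub>R f (X q))"
          unfolding FX[OF q] by (simp add: scaleR_diff_left)
        then show ?thesis unfolding XF[OF q] dist_norm[of "F q"] by (simp only: norm_minus_cancel)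
      qed
      also have "\<dots> = dist q (X q) * (norm (f (X q)) / \<epsilon>)" using \<epsilon> by simp
      also have "\<dots> \<ge> dist q (X q) * 2"
        using sep0[of "f (X q)"] map_mem X[OF q] \<epsilon> by (intro mult_left_mono) (auto simp: field_simps)
      finally show ?thesis by simp
    qed
    \<comment> \<open>\<open>F\<close> permutes \<open>Q\<close>, so the two sums of distances
      coincide and must vanish.\<close>
    have "2 * (\<Sum>q\<in>Q. dist q (X q)) \<le> (\<Sum>q\<in>Q. dist (F q) (X (F q)))"
      unfolding sum_distrib_left using exp by (rule sum_mono)
    also have "\<dots> = (\<Sum>q\<in>Q. dist q (X q))"
      using sum.reindex[OF Q.inj, of "\<lambda>q. dist q (X q)"] Q.image_eq by simp
    finally have "(\<Sum>q\<in>Q. dist q (X q)) = 0"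
      using sum_nonneg[of Q "\<lambda>q. dist q (X q)"] by simp
    then have "q = X q" if "q \<in> Q" for q
      using sum_nonneg_eq_0_iff[OF Q.finite, of "\<lambda>q. dist q (X q)"] that by simp
    then have QP: "Q \<subseteq> P" using X by (metis subsetI)
    obtain q where q: "q \<in> Q" using Q.nonempty by blast
    have "(F ^^ k) q = (f ^^ k) q" for k
    proof (induction k)
      case (Suc k)
      then show ?case using FP[OF funpow_mem[of q k]] q QP by auto
    qed simp
    then have "P \<subseteq> Q" using reach q QP Q.funpow_mem[OF q] by (metis subset_iff)
    then show "Q = P" using QP by blast
  qed
  then show ?thesis using FU FP by blast
qed

end

section \<open>Orbits shadowing a loop\<close>

context cycle
begin

text \<open>A sequence in \<open>P\<close> with \<open>X (k+1) \<le> f (X k)\<close> none of whose terms can be lowered individually.\<close>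

definition tight :: "(nat \<Rightarrow> complex) \<Rightarrow> bool" where
  "tight X \<longleftrightarrow> (\<forall>k. X k \<in> P \<and> sgn (X (Suc k)) = sgn (f (X k)) \<and> norm (X (Suc k)) \<le> norm (f (X k)) \<and>
     (\<forall>y\<in>P. sgn y = sgn (X k) \<and> norm y < norm (X k) \<and> sgn (f y) = sgn (X (Suc k)) \<longrightarrow>
        norm (f y) < norm (X (Suc k))))"

text \<open>The inner end of the slot of \<open>p\<close>: the position of the next point of
  \<open>P\<close> towards the centre, or the default \<open>0\<close> for an innermost
  point.\<close>

definition lower :: "complex \<Rightarrow> real" where
  "lower p = Max (insert 0 (norm ` {y \<in> P. sgn y = sgn p \<and> norm y < norm p}))"

text \<open>The position of the image relative to the branch of \<open>f p\<close>, negative when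
  the image lies on another branch.\<close>

definition coord :: "complex \<Rightarrow> real \<Rightarrow> real" where
  "coord p t = inner (sgn (f p)) (f (t *\<^sub>R sgn p))"

text \<open>Serves as the largest right inverse of \<open>coord p\<close> on the ray up to
  \<open>p\<close>. Taking the largest preimage makes it monotone in \<open>s\<close> even where
  \<open>f\<close> is not.\<close>

definition pull :: "complex \<Rightarrow> real \<Rightarrow> real" where
  "pull p s = Sup {t \<in> {0..norm p}. coord p t \<le> s}"

text \<open>The outer end \<open>norm (X N)\<close> of a slot, pulled back \<open>N\<close> times
  along the sequence.\<close>

primrec approx :: "nat \<Rightarrow> (nat \<Rightarrow> complex) \<Rightarrow> real" where
  "approx 0 X = norm (X 0)"
| "approx (Suc N) X = pull (X 0) (approx N (\<lambda>k. X (Suc k)))"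

definition shadow :: "(nat \<Rightarrow> complex) \<Rightarrow> real" where
  "shadow X = lim (\<lambda>N. approx N X)"

lemma tightD:
  assumes "tight X"
  shows "X k \<in> P" "sgn (X (Suc k)) = sgn (f (X k))" "norm (X (Suc k)) \<le> norm (f (X k))"
    "\<lbrakk>y \<in> P; sgn y = sgn (X k); norm y < norm (X k); sgn (f y) = sgn (X (Suc k))\<rbrakk> \<Longrightarrow> norm (f y) < norm (X (Suc k))"
  using assms unfolding tight_def by blast+

lemma tight_shift: "tight X \<Longrightarrow> tight (\<lambda>i. X (k + i))"
  by (simp add: tight_def)

lemma tight_Suc: "tight X \<Longrightarrow> tight (\<lambda>i. X (Suc i))"
  by (simp add: tight_def)

section \<open>Slots between neighbouring points of \<open>P\<close>\<close>

lemma lower_cases: "lower p = 0 \<or> (\<exists>y\<in>P. sgn y = sgn p \<and> norm y < norm p \<and> lower p = norm y)"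
proof -
  have "lower p \<in> insert 0 (norm ` {y \<in> P. sgn y = sgn p \<and> norm y < norm p})"
    unfolding lower_def by (intro Max_in) (use finite in auto)
  then show ?thesis by auto
qed

lemma lower_nonneg: "0 \<le> lower p"
  unfolding lower_def by (intro Max_ge) (use finite in auto)

lemma le_lower: "y \<in> P \<Longrightarrow> sgn y = sgn p \<Longrightarrow> norm y < norm p \<Longrightarrow> norm y \<le> lower p"
  unfolding lower_def by (intro Max_ge) (use finite in auto)

lemma lower_less: "p \<in> P \<Longrightarrow> lower p < norm p"
  using lower_cases[of p] triod by auto

lemma ray_mem_triod: "p \<in> P \<Longrightarrow> 0 \<le> t \<Longrightarrow> t \<le> norm p \<Longrightarrow> t *\<^sub>R sgn p \<in> triod"
  using triod sgn_cube[of p] by (intro scale_cube_root_mem_triod) (auto simp: mem_triod_iff)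

lemma continuous_coord: "p \<in> P \<Longrightarrow> continuous_on {0..norm p} (coord p)"
  unfolding coord_def
  by (intro continuous_intros continuous_on_compose2[OF triod_mapsD(1)[OF map]]) (auto intro: ray_mem_triod)

lemma coord_norm: "p \<in> P \<Longrightarrow> coord p (norm p) = norm (f p)"
  using inner_triod[of "sgn (f p)" "f p"] map_mem[of p] sgn_cube[of "f p"] triod
  by (auto simp: coord_def norm_scaleR_sgn)

text \<open>Here tightness enters: the next point \<open>y\<close> below \<open>X k\<close> is
  mapped to another branch or strictly below \<open>X (Suc k)\<close>, hence no farther out than the
  inner end of the next slot. As \<open>f (X k)\<close> lies at or beyond the outer end, each slot
  is stretched across the following one.\<close>

lemma coord_lower:
  assumes X: "tight X"
  shows "coord (X k) (lower (X k)) \<le> lower (X (Suc k))"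
  using lower_cases[of "X k"]
proof
  assume "lower (X k) = 0"
  then show ?thesis by (simp add: coord_def triod_mapsD(3)[OF map] lower_nonneg)
next
  assume "\<exists>y\<in>P. sgn y = sgn (X k) \<and> norm y < norm (X k) \<and> lower (X k) = norm y"
  then obtain y where y: "y \<in> P" "sgn y = sgn (X k)" "norm y < norm (X k)" "lower (X k) = norm y" by blast
  have c: "coord (X k) (lower (X k)) = inner (sgn (f (X k))) (f y)"
    using y norm_scaleR_sgn[of y] by (simp add: coord_def)
  have w: "sgn (f (X k)) ^ 3 = 1" using sgn_cube map_mem tightD(1)[OF X] by blast
  have fy: "f y \<in> P" using map_mem y by blast
  show ?thesis
  proof (cases "sgn (f y) = sgn (f (X k))")
    case True
    then have "norm (f y) < norm (X (Suc k))" using tightD(4)[OF X y(1-3)] tightD(2)[OF X, of k] by simp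
    then have "norm (f y) \<le> lower (X (Suc k))"
      using le_lower[OF fy] True tightD(2)[OF X, of k] by simp
    then show ?thesis using c inner_triod[OF w, of "f y"] fy triod True by auto
  next
    case False
    have "f y \<in> triod" "f y \<noteq> 0" using fy triod by auto
    then have "coord (X k) (lower (X k)) \<le> 0" using c inner_triod[OF w, of "f y"] False by simp
    then show ?thesis using lower_nonneg[of "X (Suc k)"] by linarith
  qed
qed

lemma pull_props:
  assumes X: "tight X" and s: "lower (X (Suc k)) \<le> s" "s \<le> norm (X (Suc k))"
  shows "lower (X k) \<le> pull (X k) s" "pull (X k) s \<le> norm (X k)" "coord (X k) (pull (X k) s) = s"
proof -
  let ?p = "X k"
  let ?S = "{t \<in> {0..norm ?p}. coord ?p t \<le> s}"
  have p: "?p \<in> P" using tightD(1)[OF X] .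
  have low: "lower ?p \<in> ?S"
    using lower_nonneg lower_less[OF p] coord_lower[OF X, of k] s(1) by auto
  have "closed ({0..norm ?p} \<inter> coord ?p -` {..s})"
    by (intro continuous_closed_preimage continuous_coord p) auto
  moreover have eq: "{0..norm ?p} \<inter> coord ?p -` {..s} = ?S" by auto
  ultimately have cl: "closed ?S" by simp
  have bdd: "bdd_above ?S" by (rule bdd_aboveI[of _ "norm ?p"]) auto
  have mem: "pull ?p s \<in> ?S"
    unfolding pull_def using closed_contains_Sup[OF _ bdd cl] low by blast
  show "lower ?p \<le> pull ?p s" unfolding pull_def by (rule cSup_upper[OF low bdd])
  show "pull ?p s \<le> norm ?p" using mem by auto
  \<comment> \<open>A value below \<open>s\<close> at the supremum would be followed by a crossing
    of \<open>s\<close> farther out, against maximality.\<close>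
  show "coord ?p (pull ?p s) = s"
  proof (rule ccontr)
    assume "coord ?p (pull ?p s) \<noteq> s"
    then have less: "coord ?p (pull ?p s) < s" using mem by auto
    have "s \<le> coord ?p (norm ?p)" using coord_norm[OF p] s(2) tightD(3)[OF X, of k] by simp
    moreover have "continuous_on {pull ?p s..norm ?p} (coord ?p)"
      by (rule continuous_on_subset[OF continuous_coord[OF p]]) (use mem in auto)
    ultimately obtain t where t: "pull ?p s \<le> t" "t \<le> norm ?p" "coord ?p t = s"
      using IVT'[of "coord ?p" "pull ?p s" s "norm ?p"] less mem by auto
    then have "t \<in> ?S" using mem by auto
    then have "t \<le> pull ?p s" unfolding pull_def by (rule cSup_upper[OF _ bdd])
    then show False using t less by auto
  qed
qed

lemma pull_mono:
  assumes X: "tight X" and "lower (X (Suc k)) \<le> s" "s \<le> s'"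
  shows "pull (X k) s \<le> pull (X k) s'"
  unfolding pull_def
proof (rule cSup_subset_mono)
  show "{t \<in> {0..norm (X k)}. coord (X k) t \<le> s} \<noteq> {}"
    using lower_nonneg[of "X k"] lower_less[OF tightD(1)[OF X], of k] coord_lower[OF X, of k] assms(2)
    by (auto intro!: exI[of _ "lower (X k)"])
qed (use assms(3) in \<open>auto intro: bdd_aboveI\<close>)

section \<open>Limits of pull-backs\<close>

lemma approx_bounds: "tight X \<Longrightarrow> lower (X 0) \<le> approx N X \<and> approx N X \<le> norm (X 0)"
proof (induction N arbitrary: X)
  case 0
  then show ?case using lower_less tightD(1) by (simp add: less_imp_le)
next
  case (Suc N)
  then show ?case using pull_props[OF Suc.prems, of 0] Suc.IH[OF tight_Suc[OF Suc.prems]] by simp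
qed

text \<open>The first pull-back cannot exceed the outer end from which the approximation starts;
  monotonicity of \<open>pull\<close> carries this comparison to all later stages.\<close>

lemma approx_decreasing: "tight X \<Longrightarrow> approx (Suc N) X \<le> approx N X"
proof (induction N arbitrary: X)
  case 0
  then show ?case using approx_bounds[OF 0, of "Suc 0"] by simp
next
  case (Suc N)
  have "pull (X 0) (approx (Suc N) (\<lambda>k. X (Suc k))) \<le> pull (X 0) (approx N (\<lambda>k. X (Suc k)))"
    using Suc.IH[OF tight_Suc[OF Suc.prems]] approx_bounds[OF tight_Suc[OF Suc.prems], of "Suc N"]
    by (intro pull_mono[OF Suc.prems]) auto
  then show ?case by simp
qed

lemma approx_tendsto: "tight X \<Longrightarrow> (\<lambda>N. approx N X) \<longlonglongrightarrow> shadow X"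
proof -
  assume X: "tight X"
  have "decseq (\<lambda>N. approx N X)" using approx_decreasing[OF X] by (rule decseq_SucI)
  then have "convergent (\<lambda>N. approx N X)"
    using approx_bounds[OF X] decseq_convergent[of "\<lambda>N. approx N X" "lower (X 0)"] by (metis convergentI)
  then show ?thesis unfolding shadow_def by (simp add: convergent_LIMSEQ_iff)
qed

lemma shadow_bounds: "tight X \<Longrightarrow> lower (X 0) \<le> shadow X \<and> shadow X \<le> norm (X 0)"
  using approx_bounds LIMSEQ_le_const[OF approx_tendsto, of X "lower (X 0)"]
    LIMSEQ_le_const2[OF approx_tendsto, of X "norm (X 0)"] by blast

lemma coord_shadow:
  assumes X: "tight X"
  shows "coord (X 0) (shadow X) = shadow (\<lambda>k. X (Suc k))"
proof -
  have b: "approx N X \<in> {0..norm (X 0)}" for N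
    using approx_bounds[OF X, of N] lower_nonneg[of "X 0"] by auto
  have "(\<lambda>N. coord (X 0) (approx (Suc N) X)) \<longlonglongrightarrow> coord (X 0) (shadow X)"
  proof (rule continuous_on_tendsto_compose[OF continuous_coord[OF tightD(1)[OF X]]])
    show "(\<lambda>N. approx (Suc N) X) \<longlonglongrightarrow> shadow X"
      using approx_tendsto[OF X] by (rule LIMSEQ_Suc)
    show "shadow X \<in> {0..norm (X 0)}"
      using shadow_bounds[OF X] lower_nonneg[of "X 0"] by auto
    show "\<forall>\<^sub>F N in sequentially. approx (Suc N) X \<in> {0..norm (X 0)}"
      using b by (intro always_eventually) blast
  qed
  moreover have "coord (X 0) (approx (Suc N) X) = approx N (\<lambda>k. X (Suc k))" for N
    using approx_bounds[OF tight_Suc[OF X], of N] pull_props(3)[OF X, of 0] by simp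
  ultimately have "(\<lambda>N. approx N (\<lambda>k. X (Suc k))) \<longlonglongrightarrow> coord (X 0) (shadow X)" by simp
  then show ?thesis using approx_tendsto[OF tight_Suc[OF X]] LIMSEQ_unique by blast
qed

definition shadow_point :: "(nat \<Rightarrow> complex) \<Rightarrow> nat \<Rightarrow> complex" where
  "shadow_point X k = shadow (\<lambda>i. X (k + i)) *\<^sub>R sgn (X k)"

text \<open>The last clause says that no point of \<open>P\<close> follows the itinerary of the loop.\<close>

definition tight_loop :: "nat \<Rightarrow> (nat \<Rightarrow> complex) \<Rightarrow> bool" where
  "tight_loop M X \<longleftrightarrow> 0 < M \<and> tight X \<and> (\<forall>k. X (k + M) = X k) \<and>
     (\<exists>k. \<exists>y\<in>P. sgn y = sgn (X k) \<and> norm y < norm (X k)) \<and>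
     \<not> (\<exists>p\<in>P. (f ^^ M) p = p \<and> (\<forall>k<M. sgn ((f ^^ k) p) = sgn (X k)))"

text \<open>Lexicographic order of the tails starting at \<open>k\<close> and \<open>l\<close>; the
  clause on \<open>sgn\<close> is there because only points of one branch are ordered.\<close>

definition lex_less :: "(nat \<Rightarrow> complex) \<Rightarrow> nat \<Rightarrow> nat \<Rightarrow> bool" where
  "lex_less X k l \<longleftrightarrow> (\<exists>d. (\<forall>i<d. X (k + i) = X (l + i)) \<and> sgn (X (k + d)) = sgn (X (l + d)) \<and>
     norm (X (k + d)) < norm (X (l + d)))"

section \<open>The periodic orbit shadowing a loop\<close>

lemma shadow_shift_bounds:
  "tight X \<Longrightarrow> lower (X k) \<le> shadow (\<lambda>i. X (k + i)) \<and> shadow (\<lambda>i. X (k + i)) \<le> norm (X k)"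
  using shadow_bounds[OF tight_shift, of X k] by simp

lemma coord_shadow_shift:
  "tight X \<Longrightarrow> coord (X k) (shadow (\<lambda>i. X (k + i))) = shadow (\<lambda>i. X (Suc k + i))"
  using coord_shadow[OF tight_shift, of X k] by simp

lemma tight_loop_shift:
  assumes "tight_loop M X"
  shows "X (k + M * j) = X k"
proof (induction j)
  case (Suc j)
  have "X ((k + M * j) + M) = X (k + M * j)" using assms by (simp add: tight_loop_def)
  then show ?case using Suc by (simp add: algebra_simps)
qed simp

text \<open>Once a shadow is \<open>0\<close>, all later ones are, since \<open>f\<close> fixes
  \<open>0\<close>. Periodicity brings this to an index \<open>l\<close> where \<open>X l\<close> is
  not innermost, and there the slot is bounded away from \<open>0\<close>.\<close>

lemma shadow_pos:
  assumes X: "tight_loop M X"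
  shows "0 < shadow (\<lambda>i. X (k + i))"
proof (rule ccontr)
  have t: "tight X" and M: "0 < M" using X by (auto simp: tight_loop_def)
  have nn: "0 \<le> shadow (\<lambda>i. X (j + i))" for j
    using shadow_shift_bounds[OF t, of j] lower_nonneg[of "X j"] by linarith
  assume "\<not> 0 < shadow (\<lambda>i. X (k + i))"
  then have z: "shadow (\<lambda>i. X (k + i)) = 0" using nn[of k] by simp
  have zero: "shadow (\<lambda>i. X (k + j + i)) = 0" for j
  proof (induction j)
    case (Suc j)
    have "coord (X (k + j)) 0 = 0" by (simp add: coord_def triod_mapsD(3)[OF map])
    then show ?case using coord_shadow_shift[OF t, of "k + j"] Suc by simp
  qed (use z in simp)
  obtain l y where y: "y \<in> P" "sgn y = sgn (X l)" "norm y < norm (X l)"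
    using X by (auto simp: tight_loop_def)
  have "k \<le> l + M * k" using M by (cases M) auto
  then have "shadow (\<lambda>i. X (l + M * k + i)) = 0" using zero[of "l + M * k - k"] by simp
  moreover have "X (l + M * k + i) = X (l + i)" for i
    using tight_loop_shift[OF X, of "l + i" k] by (simp add: algebra_simps)
  ultimately have "shadow (\<lambda>i. X (l + i)) = 0" by simp
  then have "norm y \<le> 0" using shadow_shift_bounds[OF t, of l] le_lower[OF y] by linarith
  then show False using y(1) triod by auto
qed

lemma shadow_point_props:
  assumes X: "tight_loop M X"
  shows "sgn (shadow_point X k) = sgn (X k)" "norm (shadow_point X k) = shadow (\<lambda>i. X (k + i))"
    "shadow_point X k \<in> triod - {0}" "f (shadow_point X k) = shadow_point X (Suc k)"
    "shadow_point X (k + M) = shadow_point X k"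
proof -
  have t: "tight X" using X by (auto simp: tight_loop_def)
  have p: "X k \<in> P" using tightD(1)[OF t] .
  note pos = shadow_pos[OF X]
  have w: "sgn (X k) ^ 3 = 1" by (rule sgn_cube[OF p])
  show s: "sgn (shadow_point X k) = sgn (X k)" "norm (shadow_point X k) = shadow (\<lambda>i. X (k + i))"
    using pos[of k] sgn_scale_cube_root[OF w] cube_root_norm[OF w] by (auto simp: shadow_point_def)
  have T: "shadow_point X k \<in> triod"
    unfolding shadow_point_def
    using shadow_shift_bounds[OF t, of k] pos[of k] by (intro ray_mem_triod p) auto
  then show "shadow_point X k \<in> triod - {0}" using s pos[of k] by (metis Diff_iff empty_iff insert_iff norm_zero order_less_irrefl)
  have fw: "sgn (f (X k)) ^ 3 = 1" using sgn_cube map_mem p by blast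
  \<comment> \<open>The coordinate of the image is the next shadow, which is positive; this alone
    puts the image on the expected branch and determines it.\<close>
  have "inner (sgn (f (X k))) (f (shadow_point X k)) = shadow (\<lambda>i. X (Suc k + i))"
    using coord_shadow_shift[OF t, of k] unfolding coord_def shadow_point_def .
  then show "f (shadow_point X k) = shadow_point X (Suc k)"
    using inner_triod_pos[OF fw triod_mapsD(2)[OF map T]] pos[of "Suc k"] tightD(2)[OF t, of k]
    by (simp add: shadow_point_def)
  have "X (k + M + i) = X (k + i)" for i
    using tight_loop_shift[OF X, of "k + i" 1] by (simp add: algebra_simps)
  then show "shadow_point X (k + M) = shadow_point X k"
    using tight_loop_shift[OF X, of k 1] by (simp add: shadow_point_def)
qed

lemma shadow_point_funpow:
  assumes X: "tight_loop M X"
  shows "(f ^^ j) (shadow_point X k) = shadow_point X (k + j)"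
  by (induction j) (auto simp: shadow_point_props[OF X])

lemma shadow_point_shift:
  assumes X: "tight_loop M X"
  shows "shadow_point X (k + M * j) = shadow_point X k"
proof (induction j)
  case (Suc j)
  have "shadow_point X ((k + M * j) + M) = shadow_point X (k + M * j)"
    by (rule shadow_point_props(5)[OF X])
  then show ?case using Suc by (simp add: algebra_simps)
qed simp

text \<open>Such a point would lead to one of \<open>P\<close> returning after \<open>M\<close>
  steps with the itinerary of \<open>X\<close>, which \<open>tight_loop\<close> excludes.\<close>

lemma shadow_point_notin:
  assumes X: "tight_loop M X"
  shows "shadow_point X k \<notin> P"
proof
  assume a: "shadow_point X k \<in> P"
  have M: "0 < M" using X by (simp add: tight_loop_def)
  have "k \<le> M * k" using M by simp
  then have "(f ^^ (M * k - k)) (shadow_point X k) = shadow_point X (0 + M * k)"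
    unfolding shadow_point_funpow[OF X] by simp
  also have "\<dots> = shadow_point X 0" by (rule shadow_point_shift[OF X])
  finally have p: "shadow_point X 0 \<in> P" using funpow_mem[OF a] by metis
  have "(f ^^ M) (shadow_point X 0) = shadow_point X 0"
    unfolding shadow_point_funpow[OF X] using shadow_point_props(5)[OF X, of 0] by simp
  moreover have "sgn ((f ^^ j) (shadow_point X 0)) = sgn (X j)" for j
    unfolding shadow_point_funpow[OF X] using shadow_point_props(1)[OF X, of j] by simp
  ultimately show False using X p unfolding tight_loop_def by blast
qed

text \<open>At the first difference the slots are in order, and equality would put a point of
  \<open>P\<close> on the orbit. Before it, both shadows are pulled back along the same
  \<open>X k\<close> by a monotone map, and strictness survives because \<open>coord\<close>
  recovers the distinct later shadows.\<close>

lemma shadow_less_of_lex_less: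
  assumes X: "tight_loop M X"
  shows "lex_less X k l \<Longrightarrow> shadow (\<lambda>i. X (k + i)) < shadow (\<lambda>i. X (l + i))"
proof -
  have t: "tight X" using X by (auto simp: tight_loop_def)
  have "\<lbrakk>\<forall>i<d. X (k + i) = X (l + i); sgn (X (k + d)) = sgn (X (l + d)); norm (X (k + d)) < norm (X (l + d))\<rbrakk>
    \<Longrightarrow> shadow (\<lambda>i. X (k + i)) < shadow (\<lambda>i. X (l + i))" for d
  proof (induction d arbitrary: k l)
    case 0
    have p: "X k \<in> P" using tightD(1)[OF t] .
    have le: "norm (X k) \<le> lower (X l)" using 0 p by (intro le_lower) auto
    have "shadow (\<lambda>i. X (k + i)) \<noteq> norm (X k)"
      using shadow_point_notin[OF X, of k] p shadow_point_props(1,2)[OF X, of k] sgn_norm_eqI by metis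
    then show ?case using le shadow_shift_bounds[OF t, of k] shadow_shift_bounds[OF t, of l] by linarith
  next
    case (Suc d)
    have Xkl: "X k = X l" using Suc.prems(1) by (metis add_0_right zero_less_Suc)
    have IH: "shadow (\<lambda>i. X (Suc k + i)) < shadow (\<lambda>i. X (Suc l + i))"
      using Suc.prems by (intro Suc.IH) auto
    \<comment> \<open>\<open>pull\<close> need not be continuous, so its monotonicity is applied to
      the approximations, which are eventually ordered because their limits are strictly
      ordered.\<close>
    let ?a = "\<lambda>N. approx N (\<lambda>i. X (Suc k + i))" and ?b = "\<lambda>N. approx N (\<lambda>i. X (Suc l + i))"
    have "\<forall>\<^sub>F N in sequentially. ?a N < ?b N"
    proof -
      obtain c where c: "shadow (\<lambda>i. X (Suc k + i)) < c" "c < shadow (\<lambda>i. X (Suc l + i))"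
        using IH dense by blast
      show ?thesis
        using order_tendstoD(2)[OF approx_tendsto[OF tight_shift[OF t]] c(1)]
          order_tendstoD(1)[OF approx_tendsto[OF tight_shift[OF t]] c(2)]
        by eventually_elim linarith
    qed
    then have "\<forall>\<^sub>F N in sequentially. approx (Suc N) (\<lambda>i. X (k + i)) \<le> approx (Suc N) (\<lambda>i. X (l + i))"
    proof eventually_elim
      case (elim N)
      have "lower (X (Suc k)) \<le> ?a N" using approx_bounds[OF tight_shift[OF t, of "Suc k"], of N] by simp
      then have "pull (X k) (?a N) \<le> pull (X k) (?b N)" using elim by (intro pull_mono[OF t]) auto
      then show ?case using Xkl by simp
    qed
    then have "shadow (\<lambda>i. X (k + i)) \<le> shadow (\<lambda>i. X (l + i))"
      using LIMSEQ_Suc[OF approx_tendsto[OF tight_shift[OF t]]]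
      by (intro tendsto_le[OF sequentially_bot, of "\<lambda>N. approx (Suc N) (\<lambda>i. X (l + i))" _
          "\<lambda>N. approx (Suc N) (\<lambda>i. X (k + i))"]) auto
    moreover have "shadow (\<lambda>i. X (k + i)) \<noteq> shadow (\<lambda>i. X (l + i))"
      using IH coord_shadow_shift[OF t, of k] coord_shadow_shift[OF t, of l] Xkl by auto
    ultimately show ?case by linarith
  qed
  then show "lex_less X k l \<Longrightarrow> shadow (\<lambda>i. X (k + i)) < shadow (\<lambda>i. X (l + i))"
    unfolding lex_less_def by blast
qed

text \<open>Where the tails first differ, the branches still agree: they are dictated by the equal
  preceding terms, or by \<open>s\<close> at index \<open>0\<close>.\<close>

lemma lex_cases:
  assumes t: "tight X" and s: "sgn (X k) = sgn (X l)"
  shows "lex_less X k l \<or> lex_less X l k \<or> (\<forall>i. X (k + i) = X (l + i))"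
proof (rule ccontr)
  assume c: "\<not> ?thesis"
  define d where "d = (LEAST d. X (k + d) \<noteq> X (l + d))"
  have d: "X (k + d) \<noteq> X (l + d)" unfolding d_def using c by (metis (mono_tags, lifting) LeastI)
  have eq: "X (k + i) = X (l + i)" if "i < d" for i using not_less_Least[of i] that unfolding d_def by blast
  have "sgn (X (k + d)) = sgn (X (l + d))"
  proof (cases d)
    case (Suc e)
    then show ?thesis using tightD(2)[OF t, of "k + e"] tightD(2)[OF t, of "l + e"] eq[of e] by simp
  qed (use s in simp)
  moreover from this have "norm (X (k + d)) \<noteq> norm (X (l + d))" using d sgn_norm_eqI by blast
  ultimately show False
    using c eq unfolding lex_less_def by (metis linorder_neqE_linordered_idom)
qed

lemma shadow_less_iff:
  assumes X: "tight_loop M X" and s: "sgn (X k) = sgn (X l)"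
  shows "shadow (\<lambda>i. X (k + i)) < shadow (\<lambda>i. X (l + i)) \<longleftrightarrow> lex_less X k l"
proof
  assume l: "shadow (\<lambda>i. X (k + i)) < shadow (\<lambda>i. X (l + i))"
  have t: "tight X" using X by (auto simp: tight_loop_def)
  have "\<not> (\<forall>i. X (k + i) = X (l + i))"
  proof
    assume "\<forall>i. X (k + i) = X (l + i)"
    then have "(\<lambda>i. X (k + i)) = (\<lambda>i. X (l + i))" by blast
    then show False using l by simp
  qed
  then show "lex_less X k l"
    using lex_cases[OF t s] l shadow_less_of_lex_less[OF X, of l k] by force
qed (rule shadow_less_of_lex_less[OF X])

lemma shadow_point_eq_iff:
  assumes X: "tight_loop M X"
  shows "shadow_point X k = shadow_point X l \<longleftrightarrow> (\<forall>i. X (k + i) = X (l + i))"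
proof
  assume e: "shadow_point X k = shadow_point X l"
  have t: "tight X" using X by (auto simp: tight_loop_def)
  have "sgn (X k) = sgn (X l)" "shadow (\<lambda>i. X (k + i)) = shadow (\<lambda>i. X (l + i))"
    using e shadow_point_props(1,2)[OF X] by metis+
  then show "\<forall>i. X (k + i) = X (l + i)"
    using lex_cases[OF t] shadow_less_of_lex_less[OF X] by force
next
  assume e: "\<forall>i. X (k + i) = X (l + i)"
  then have "X k = X l" by (metis add_0_right)
  then show "shadow_point X k = shadow_point X l" using e by (simp add: shadow_point_def)
qed

section \<open>The pattern of the shadowing orbit\<close>

lemma shadow_cycle:
  assumes X: "tight_loop M X"
  shows "(f, range (shadow_point X)) \<in> cycles"
proof -
  have "(f ^^ M) (shadow_point X 0) = shadow_point X 0" "0 < M"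
    using shadow_point_funpow[OF X, of M 0] shadow_point_props(5)[OF X, of 0] X by (auto simp: tight_loop_def)
  moreover have "range (shadow_point X) = range (\<lambda>k. (f ^^ k) (shadow_point X 0))"
    by (simp add: shadow_point_funpow[OF X])
  moreover have "shadow_point X 0 \<in> triod" using shadow_point_props(3)[OF X, of 0] by simp
  ultimately have "periodic_orbit f (range (shadow_point X))"
    unfolding periodic_orbit_def by blast
  moreover have "range (shadow_point X) \<noteq> {0}" using shadow_point_props(3)[OF X, of 0] by blast
  ultimately show ?thesis using map by (simp add: cycles_def)
qed

text \<open>A conjugation would carry some \<open>p\<close> of \<open>P\<close> to the first shadow
  point, and \<open>p\<close> would then follow the itinerary of \<open>X\<close>.\<close>

lemma shadow_not_equivalent:
  assumes X: "tight_loop M X"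
  shows "\<not> conjugation f P f (range (shadow_point X)) h"
proof
  assume h: "conjugation f P f (range (shadow_point X)) h"
  then obtain p where p: "p \<in> P" "h p = shadow_point X 0" by (metis conjugation_def imageE rangeI)
  have hk: "h ((f ^^ k) p) = shadow_point X k" for k
    using conjugation_funpow[OF h _ p(1), of k] image_eq shadow_point_funpow[OF X, of k 0] p(2) by simp
  have "h ((f ^^ M) p) = h p" using hk[of M] p(2) shadow_point_props(5)[OF X, of 0] by simp
  then have "(f ^^ M) p = p" using conjugation_inj[OF h] funpow_mem p(1) by (auto dest: inj_onD)
  moreover have "sgn ((f ^^ k) p) = sgn (X k)" for k
    using conjugationD(3)[OF h funpow_mem[OF p(1)], of k] hk[of k] shadow_point_props(1)[OF X, of k] by simp
  ultimately show False using X p(1) unfolding tight_loop_def by blast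
qed

text \<open>Shadow points have the colours of the terms of \<open>X\<close>. The period of the orbit
  may be smaller than \<open>M\<close>, so averages are compared over \<open>M\<close>
  steps.\<close>

lemma shadow_rotation_number:
  assumes X: "tight_loop M X" and b: "numbering b" and w: "(\<Sum>k<M. weight b (X k)) = 0"
  shows "rotation_number b f (range (shadow_point X)) = rotation_number b f P"
proof -
  interpret Q: cycle f "range (shadow_point X)" using shadow_cycle[OF X] by (simp add: cycle_def)
  have t: "tight X" and M: "0 < M" using X by (auto simp: tight_loop_def)
  have col: "colour b f (shadow_point X k) = colour b f (X k)" for k
    using shadow_point_props[OF X, of k] shadow_point_props[OF X, of "Suc k"] tightD[OF t, of k]
      tightD(1)[OF t, of k] map_mem[of "X k"] triod
    by (intro colour_cong[OF b]) auto
  have "(f ^^ M) (shadow_point X 0) = shadow_point X 0"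
    using shadow_point_funpow[OF X, of M 0] shadow_point_props(5)[OF X, of 0] by simp
  then have "int (card (range (shadow_point X))) * (\<Sum>j<M. colour b f (X j)) = int M * Q.wind b"
    using Q.sum_weight_return[of "shadow_point X 0" M b] Q.sum_weight_orbit[of b "shadow_point X 0" M]
    by (simp add: shadow_point_funpow[OF X] col)
  then have 1: "real (card (range (shadow_point X))) * of_int (\<Sum>j<M. colour b f (X j)) = real M * of_int (Q.wind b)"
    by (metis of_int_mult of_int_of_nat_eq)
  have "int (card P) * (\<Sum>j<M. colour b f (X j)) = int M * wind b"
    using w by (simp add: weight_def sum_subtractf sum_distrib_left)
  then have 2: "real (card P) * of_int (\<Sum>j<M. colour b f (X j)) = real M * of_int (wind b)"
    by (metis of_int_mult of_int_of_nat_eq)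
  have "real M * of_int (wind b) * real (card (range (shadow_point X))) = real M * of_int (Q.wind b) * real (card P)"
    unfolding 1[symmetric] 2[symmetric] by simp
  then show ?thesis
    using M card_pos Q.card_pos by (simp add: rotation_number_eq Q.rotation_number_eq field_simps)
qed

end

text \<open>Tight loops are defined by branches, by the order along branches and by the map on
  \<open>P\<close>, all of which a conjugation respects. This transports the construction to every
  map with an equivalent cycle.\<close>

lemma tight_loop_conjugation:
  assumes P: "cycle f P" and Q: "cycle g Q" and h: "conjugation f P g Q h" and X: "cycle.tight_loop f P M X"
  shows "cycle.tight_loop g Q M (\<lambda>k. h (X k))"
proof -
  interpret P: cycle f P by fact
  interpret Q: cycle g Q by fact
  have t: "P.tight X" using X by (auto simp: P.tight_loop_def)
  have Qh: "\<exists>x\<in>P. y = h x" if "y \<in> Q" for y using h that by (auto simp: conjugation_def)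
  have gh: "g (h x) = h (f x)" if "x \<in> P" for x using conjugationD(2)[OF h that] by simp
  have sh: "sgn (h x) = sgn x" if "x \<in> P" for x using conjugationD(3)[OF h that] .
  note XP = P.tightD(1)[OF t]
  have "Q.tight (\<lambda>k. h (X k))"
    unfolding Q.tight_def
  proof (intro allI conjI ballI impI)
    fix k
    have fX: "f (X k) \<in> P" using P.map_mem XP by blast
    show "h (X k) \<in> Q" using conjugationD(1)[OF h XP] .
    show "sgn (h (X (Suc k))) = sgn (g (h (X k)))"
      using gh[OF XP] sh[OF XP] sh[OF fX] P.tightD(2)[OF t, of k] by simp
    show "norm (h (X (Suc k))) \<le> norm (g (h (X k)))"
      using conjugation_le_iff[OF h XP fX P.tightD(2)[OF t, of k]] P.tightD(3)[OF t, of k] gh[OF XP] by simp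
    fix y assume y: "y \<in> Q" "sgn y = sgn (h (X k)) \<and> norm y < norm (h (X k)) \<and> sgn (g y) = sgn (h (X (Suc k)))"
    obtain x where x: "x \<in> P" "y = h x" using Qh y(1) by blast
    have s: "sgn x = sgn (X k)" "sgn (f x) = sgn (X (Suc k))"
      using y x sh gh XP P.map_mem by auto
    have "norm x < norm (X k)" using conjugation_less_iff[OF h x(1) XP s(1)] y x by simp
    then have "norm (f x) < norm (X (Suc k))" using P.tightD(4)[OF t x(1) s(1) _ s(2)] by blast
    then show "norm (g y) < norm (h (X (Suc k)))"
      using conjugation_less_iff[OF h P.map_mem[OF x(1)] XP s(2)] x gh by simp
  qed
  moreover have "\<exists>k. \<exists>y\<in>Q. sgn y = sgn (h (X k)) \<and> norm y < norm (h (X k))"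
  proof -
    obtain k y where y: "y \<in> P" "sgn y = sgn (X k)" "norm y < norm (X k)"
      using X by (auto simp: P.tight_loop_def)
    then show ?thesis
      using conjugation_less_iff[OF h y(1) XP y(2)] sh[OF y(1)] sh[OF XP] conjugationD(1)[OF h y(1)] by metis
  qed
  moreover have "\<not> (\<exists>q\<in>Q. (g ^^ M) q = q \<and> (\<forall>k<M. sgn ((g ^^ k) q) = sgn (h (X k))))"
  proof
    assume "\<exists>q\<in>Q. (g ^^ M) q = q \<and> (\<forall>k<M. sgn ((g ^^ k) q) = sgn (h (X k)))"
    then obtain q where q: "q \<in> Q" "(g ^^ M) q = q" "\<forall>k<M. sgn ((g ^^ k) q) = sgn (h (X k))" by blast
    obtain p where p: "p \<in> P" "q = h p" using Qh q(1) by blast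
    have gk: "(g ^^ k) q = h ((f ^^ k) p)" for k
      using conjugation_funpow[OF h _ p(1)] P.image_eq p(2) by simp
    have "(f ^^ M) p = p"
      using conjugation_inj[OF h] gk[of M] q(2) p P.funpow_mem[OF p(1)] by (auto dest: inj_onD)
    moreover have "\<forall>k<M. sgn ((f ^^ k) p) = sgn (X k)"
      using q(3) gk sh[OF P.funpow_mem[OF p(1)]] sh[OF XP] by simp
    ultimately show False using X p(1) unfolding P.tight_loop_def by blast
  qed
  ultimately show ?thesis
    using X by (simp add: P.tight_loop_def Q.tight_loop_def)
qed

text \<open>Shadow points are matched by index: their coincidences and their order are decided by
  the itineraries alone.\<close>

lemma shadow_conjugation:
  assumes P: "cycle f P" and Q: "cycle g Q" and h: "conjugation f P g Q h" and X: "cycle.tight_loop f P M X"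
  shows "\<exists>k. conjugation f (range (cycle.shadow_point f X)) g (range (cycle.shadow_point g (\<lambda>k. h (X k)))) k"
proof -
  interpret P: cycle f P by fact
  interpret Q: cycle g Q by fact
  define Y where "Y k = h (X k)" for k
  have Y: "Q.tight_loop M Y" using tight_loop_conjugation[OF assms] unfolding Y_def .
  have XP: "X k \<in> P" for k using X P.tightD(1) by (auto simp: P.tight_loop_def)
  have XY: "X k = X l \<longleftrightarrow> Y k = Y l" for k l
    unfolding Y_def using conjugation_inj[OF h] XP by (auto dest: inj_onD)
  have sY: "sgn (Y k) = sgn (X k)" for k
    unfolding Y_def using conjugationD(3)[OF h XP] .
  have lex: "P.lex_less X k l \<longleftrightarrow> Q.lex_less Y k l" for k l
    unfolding P.lex_less_def Q.lex_less_def XY sY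
    using conjugation_less_iff[OF h XP XP] by (metis Y_def)
  \<comment> \<open>Several indices may give the same point; \<open>XY\<close> and
    \<open>shadow_point_eq_iff\<close> make the choice immaterial.\<close>
  define \<phi> where "\<phi> z = Q.shadow_point Y (SOME k. P.shadow_point X k = z)" for z
  have \<phi>: "\<phi> (P.shadow_point X k) = Q.shadow_point Y k" for k
  proof -
    define l where "l = (SOME l. P.shadow_point X l = P.shadow_point X k)"
    have "P.shadow_point X l = P.shadow_point X k"
      unfolding l_def by (rule someI[of _ k]) simp
    then have "Q.shadow_point Y l = Q.shadow_point Y k"
      unfolding P.shadow_point_eq_iff[OF X] Q.shadow_point_eq_iff[OF Y] XY .
    then show ?thesis by (simp add: \<phi>_def l_def)
  qed
  have "conjugation f (range (P.shadow_point X)) g (range (Q.shadow_point Y)) \<phi>"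
    unfolding conjugation_def
  proof (intro conjI ballI impI)
    show "\<phi> ` range (P.shadow_point X) = range (Q.shadow_point Y)" by (simp add: image_image \<phi>)
    fix x assume "x \<in> range (P.shadow_point X)"
    then obtain k where k: "x = P.shadow_point X k" by blast
    show "\<phi> (f x) = g (\<phi> x)"
      by (simp add: k \<phi> P.shadow_point_props[OF X] Q.shadow_point_props[OF Y])
    show "sgn (\<phi> x) = sgn x"
      by (simp add: k \<phi> P.shadow_point_props[OF X] Q.shadow_point_props[OF Y] sY)
    fix y assume "y \<in> range (P.shadow_point X)" and xy: "sgn x = sgn y \<and> norm x < norm y"
    then obtain l where l: "y = P.shadow_point X l" by blast
    have s: "sgn (X k) = sgn (X l)" using xy by (simp add: k l P.shadow_point_props[OF X])
    have "P.lex_less X k l"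
      using xy P.shadow_less_iff[OF X s] by (simp add: k l P.shadow_point_props[OF X])
    then have "Q.lex_less Y k l" using lex by blast
    then show "norm (\<phi> x) < norm (\<phi> y)"
      using Q.shadow_less_of_lex_less[OF Y] by (simp add: k l \<phi> Q.shadow_point_props[OF Y])
  qed
  then show ?thesis unfolding Y_def by blast
qed

context cycle
begin

text \<open>The witness is the pattern of the shadowing orbit, found in every map with a cycle of
  the given pattern by carrying the loop over with a conjugation.\<close>

lemma forces_shadow_pattern:
  assumes X: "tight_loop M X" and b: "numbering b" and w: "(\<Sum>k<M. weight b (X k)) = 0"
  shows "\<exists>B\<in>patterns. B \<noteq> pattern_of f P \<and> forces (pattern_of f P) B \<and>
    pattern_rotation_number b B = rotation_number b f P"
proof (intro bexI conjI)
  let ?B = "pattern_of f (range (shadow_point X))"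
  note c = shadow_cycle[OF X]
  show B: "?B \<in> patterns" by (rule pattern_of_mem_patterns[OF c])
  show "?B \<noteq> pattern_of f P"
  proof
    assume "?B = pattern_of f P"
    then have "(f, range (shadow_point X)) \<in> pattern_of f P" using mem_pattern_of_self[OF c] by simp
    then show False using shadow_not_equivalent[OF X] by (auto simp: mem_pattern_of_iff)
  qed
  show "forces (pattern_of f P) ?B"
    unfolding forces_def
  proof (intro ballI impI)
    fix g assume "\<exists>Q. (g, Q) \<in> pattern_of f P"
    then obtain Q h where Q: "(g, Q) \<in> cycles" "conjugation f P g Q h" by (auto simp: mem_pattern_of_iff)
    interpret Q: cycle g Q using Q(1) by (simp add: cycle_def)
    have "(g, range (Q.shadow_point (\<lambda>k. h (X k)))) \<in> cycles"
      using Q.shadow_cycle[OF tight_loop_conjugation[OF cycle_axioms Q.cycle_axioms Q(2) X]] .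
    then show "\<exists>R. (g, R) \<in> ?B"
      using shadow_conjugation[OF cycle_axioms Q.cycle_axioms Q(2) X] c by (auto simp: mem_pattern_of_iff)
  qed
  show "pattern_rotation_number b ?B = rotation_number b f P"
    using pattern_rotation_number_eq[OF B mem_pattern_of_self[OF c] b] shadow_rotation_number[OF X b w] by simp
qed

end

section \<open>Loops of prescribed rotation number\<close>

lemma nth_concat_replicate:
  "j < e * length xs \<Longrightarrow> concat (replicate e xs) ! j = xs ! (j mod length xs)"
proof (induction e arbitrary: j)
  case (Suc e)
  show ?case
  proof (cases "j < length xs")
    case False
    then have "concat (replicate e xs) ! (j - length xs) = xs ! ((j - length xs) mod length xs)"
      using Suc.prems by (intro Suc.IH) auto
    then show ?thesis using False by (simp add: nth_append le_mod_geq)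
  qed (simp add: nth_append)
qed simp

lemma length_concat_replicate: "length (concat (replicate e xs)) = e * length xs"
  by (induction e) auto

section \<open>Tightening closed pseudo-orbits\<close>

context cycle
begin

definition weak_loop :: "nat \<Rightarrow> (nat \<Rightarrow> complex) \<Rightarrow> bool" where
  "weak_loop M X \<longleftrightarrow> 0 < M \<and> (\<forall>k. X k \<in> P \<and> sgn (X (Suc k)) = sgn (f (X k)) \<and>
     norm (X (Suc k)) \<le> norm (f (X k)) \<and> X (k + M) = X k)"

lemma weak_loop_mod:
  assumes "weak_loop M X"
  shows "X (k mod M) = X k"
proof -
  have "X (i + M * j) = X i" for i j
  proof (induction j)
    case (Suc j)
    have "X ((i + M * j) + M) = X (i + M * j)" using assms by (simp add: weak_loop_def)
    then show ?case using Suc by (simp add: algebra_simps)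
  qed simp
  from this[of "k mod M" "k div M"] show ?thesis by simp
qed

text \<open>Among the loops with the prescribed branches, one that minimizes the sum of ranks over a
  period is tight: a term that could be lowered would give a smaller sum.\<close>

lemma weak_loop_minimal:
  assumes X: "weak_loop M X"
  shows "\<exists>Y. weak_loop M Y \<and> tight Y \<and> (\<forall>k. sgn (Y k) = sgn (X k))"
proof -
  \<comment> \<open>A natural-number substitute for the norm, so that a minimum exists.\<close>
  define rank where "rank p = card {y \<in> P. norm y < norm p}" for p :: complex
  define A where "A Y \<longleftrightarrow> weak_loop M Y \<and> (\<forall>k. sgn (Y k) = sgn (X k))" for Y
  obtain Y where Y: "A Y" and min: "\<And>Z. A Z \<Longrightarrow> (\<Sum>k<M. rank (Y k)) \<le> (\<Sum>k<M. rank (Z k))"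
    using ex_has_least_nat[of A X "\<lambda>Y. \<Sum>k<M. rank (Y k)"] X by (auto simp: A_def)
  have wl: "weak_loop M Y" and sY: "\<And>k. sgn (Y k) = sgn (X k)" using Y by (auto simp: A_def)
  have YP: "Y k \<in> P" and Ys: "sgn (Y (Suc k)) = sgn (f (Y k))" and Yn: "norm (Y (Suc k)) \<le> norm (f (Y k))"
    and Yper: "Y (k + M) = Y k" and M: "0 < M" for k
    using wl by (auto simp: weak_loop_def)
  have "norm (f y) < norm (Y (Suc k))"
    if y: "y \<in> P" "sgn y = sgn (Y k)" "norm y < norm (Y k)" "sgn (f y) = sgn (Y (Suc k))" for k y
  proof (rule ccontr)
    assume c: "\<not> norm (f y) < norm (Y (Suc k))"
    \<comment> \<open>The term is lowered at all indices congruent to \<open>k\<close>, to keep the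
      period \<open>M\<close>.\<close>
    define Z where "Z i = (if i mod M = k mod M then y else Y i)" for i
    have eqk: "Y i = Y k \<and> Y (Suc i) = Y (Suc k)" if "i mod M = k mod M" for i
      using weak_loop_mod[OF wl, of i] weak_loop_mod[OF wl, of k] weak_loop_mod[OF wl, of "Suc i"]
        weak_loop_mod[OF wl, of "Suc k"] that mod_Suc_eq by metis
    have ZY: "sgn (Z i) = sgn (Y i) \<and> norm (Z i) \<le> norm (Y i) \<and> Z i \<in> P" for i
      using eqk[of i] y YP[of i] by (auto simp: Z_def)
    have Zf: "sgn (f (Z i)) = sgn (Y (Suc i)) \<and> norm (Y (Suc i)) \<le> norm (f (Z i))" for i
      using eqk[of i] y(4) c Ys[of i] Yn[of i] by (auto simp: Z_def)
    have "weak_loop M Z"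
      unfolding weak_loop_def
    proof (intro conjI allI M)
      fix i
      show "Z i \<in> P" "sgn (Z (Suc i)) = sgn (f (Z i))" using ZY Zf by auto
      show "norm (Z (Suc i)) \<le> norm (f (Z i))" using ZY[of "Suc i"] Zf[of i] by linarith
      show "Z (i + M) = Z i" using Yper[of i] by (simp add: Z_def)
    qed
    then have "A Z" using ZY sY by (simp add: A_def)
    moreover have "(\<Sum>i<M. rank (Z i)) < (\<Sum>i<M. rank (Y i))"
    proof (rule sum_strict_mono_ex1)
      show "\<forall>i\<in>{..<M}. rank (Z i) \<le> rank (Y i)"
      proof
        fix i
        have "{u \<in> P. norm u < norm (Z i)} \<subseteq> {u \<in> P. norm u < norm (Y i)}"
          using ZY[of i] by auto
        then show "rank (Z i) \<le> rank (Y i)" unfolding rank_def by (intro card_mono) (use finite in auto)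
      qed
      have "rank y < rank (Y k)"
        unfolding rank_def
      proof (rule psubset_card_mono)
        show "{u \<in> P. norm u < norm y} \<subset> {u \<in> P. norm u < norm (Y k)}" using y(1,3) by auto
      qed (use finite in auto)
      then show "\<exists>i\<in>{..<M}. rank (Z i) < rank (Y i)"
        using M eqk[of "k mod M"] by (intro bexI[of _ "k mod M"]) (auto simp: Z_def)
    qed simp
    ultimately show False using min[of Z] by simp
  qed
  then have "tight Y" unfolding tight_def using YP Ys Yn by blast
  then show ?thesis using wl sY by blast
qed

text \<open>The list omits the end point \<open>y\<close>, so that paths are joined by
  \<open>@\<close> and a closed path lists its period exactly once.\<close>

primrec wpath :: "complex \<Rightarrow> complex list \<Rightarrow> complex \<Rightarrow> bool" where
  "wpath x [] y \<longleftrightarrow> x = y"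
| "wpath x (p # ps) y \<longleftrightarrow> p = x \<and> x \<in> P \<and> (\<exists>x'. sgn x' = sgn (f x) \<and> norm x' \<le> norm (f x) \<and> wpath x' ps y)"

lemma wpath_append: "wpath x xs y \<Longrightarrow> wpath y ys z \<Longrightarrow> wpath x (xs @ ys) z"
  by (induction xs arbitrary: x) auto

lemma wpath_replicate: "wpath x xs x \<Longrightarrow> wpath x (concat (replicate e xs)) x"
  by (induction e) (auto intro: wpath_append)

lemma wpath_single: "x \<in> P \<Longrightarrow> sgn y = sgn (f x) \<Longrightarrow> norm y \<le> norm (f x) \<Longrightarrow> wpath x [x] y"
  by auto

definition orbit_list :: "complex \<Rightarrow> nat \<Rightarrow> complex list" where
  "orbit_list x m = map (\<lambda>j. (f ^^ j) x) [0..<m]"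

lemma wpath_orbit: "x \<in> P \<Longrightarrow> wpath x (orbit_list x m) ((f ^^ m) x)"
proof (induction m)
  case (Suc m)
  have "wpath ((f ^^ m) x) [(f ^^ m) x] ((f ^^ Suc m) x)"
    using funpow_mem[OF Suc.prems, of m] by (intro wpath_single) auto
  then show ?case using wpath_append Suc by (fastforce simp: orbit_list_def)
qed (simp add: orbit_list_def)

text \<open>The inward jump is made at the last step; this is how an orbit segment is closed up at a
  lower point.\<close>

lemma wpath_orbit_drop:
  assumes "x \<in> P" "sgn y = sgn ((f ^^ m) x)" "norm y \<le> norm ((f ^^ m) x)" "0 < m"
  shows "wpath x (orbit_list x m) y"
proof -
  obtain k where k: "m = Suc k" using assms(4) by (cases m) auto
  have "wpath ((f ^^ k) x) [(f ^^ k) x] y"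
    using funpow_mem[OF assms(1), of k] assms(2,3) by (intro wpath_single) (auto simp: k)
  then have "wpath x (orbit_list x k @ [(f ^^ k) x]) y"
    using wpath_append wpath_orbit[OF assms(1)] by blast
  then show ?thesis by (simp add: orbit_list_def k)
qed

lemma wpath_nth:
  "wpath x xs y \<Longrightarrow> i < length xs \<Longrightarrow> xs ! i \<in> P \<and> sgn ((xs @ [y]) ! Suc i) = sgn (f (xs ! i)) \<and>
    norm ((xs @ [y]) ! Suc i) \<le> norm (f (xs ! i))"
proof (induction xs arbitrary: x i)
  case (Cons p ps)
  obtain x' where x': "sgn x' = sgn (f x)" "norm x' \<le> norm (f x)" "wpath x' ps y" and p: "p = x" "x \<in> P"
    using Cons.prems(1) by auto
  have hd: "(ps @ [y]) ! 0 = x'" using x'(3) by (cases ps) auto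
  show ?case
  proof (cases i)
    case 0
    then show ?thesis using x' p hd by simp
  next
    case (Suc j)
    then show ?thesis using Cons.IH[OF x'(3), of j] Cons.prems(2) by simp
  qed
qed simp

lemma weak_loop_of_wpath:
  assumes w: "wpath x xs x" and "xs \<noteq> []"
  shows "weak_loop (length xs) (\<lambda>k. xs ! (k mod length xs))"
  unfolding weak_loop_def
proof (intro conjI allI)
  let ?M = "length xs"
  show M: "0 < ?M" using assms(2) by simp
  fix k
  have hd: "xs ! 0 = x" using w assms(2) by (cases xs) auto
  have i: "k mod ?M < ?M" using M by simp
  \<comment> \<open>The appended \<open>x\<close> equals the first entry, so running off the end
    agrees with reducing the index modulo the length.\<close>
  have "(xs @ [x]) ! Suc (k mod ?M) = xs ! (Suc k mod ?M)"
  proof (cases "Suc (k mod ?M) = ?M")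
    case True
    then have "Suc k mod ?M = 0" by (simp add: mod_Suc)
    then show ?thesis using True hd by (metis nth_append_length)
  next
    case False
    then have "Suc k mod ?M = Suc (k mod ?M)" by (simp add: mod_Suc)
    then show ?thesis using False i by (simp add: nth_append)
  qed
  then show "xs ! (k mod ?M) \<in> P" "sgn (xs ! (Suc k mod ?M)) = sgn (f (xs ! (k mod ?M)))"
    "norm (xs ! (Suc k mod ?M)) \<le> norm (f (xs ! (k mod ?M)))"
    using wpath_nth[OF w i] by auto
qed simp

lemma sum_list_weight_orbit: "(\<Sum>p\<leftarrow>orbit_list x m. weight b p) = (\<Sum>j<m. weight b ((f ^^ j) x))"
  by (simp add: orbit_list_def interv_sum_list_conv_sum_set_nat atLeast0LessThan)

lemma sum_list_weight_replicate:
  "(\<Sum>p\<leftarrow>concat (replicate e xs). weight b p) = int e * (\<Sum>p\<leftarrow>xs. weight b p)"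
  by (induction e) (auto simp: algebra_simps)

lemma sum_weight_list: "(\<Sum>k<length xs. weight b (xs ! (k mod length xs))) = (\<Sum>p\<leftarrow>xs. weight b p)"
  by (simp add: sum_list_sum_nth atLeast0LessThan)

text \<open>The image of the innermost point of one branch lies on the next branch, no closer to
  \<open>0\<close> than the innermost point there. Jumping inwards to that point closes a loop all
  of whose steps have displacement \<open>1/3\<close>.\<close>

lemma innermost_loop:
  assumes "canonical_for_cycle b f P"
  obtains \<beta> where "\<And>i. i < 3 \<Longrightarrow> \<beta> i \<in> P \<and> \<beta> i \<in> b i \<and> colour b f (\<beta> i) = 1"
    "\<And>i y. \<lbrakk>i < 3; y \<in> P; sgn y = sgn (\<beta> i)\<rbrakk> \<Longrightarrow> norm (\<beta> i) \<le> norm y"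
    "wpath (\<beta> 0) [\<beta> 0, \<beta> 1, \<beta> 2] (\<beta> 0)"
proof -
  have b: "numbering b" using assms by (simp add: canonical_for_cycle_def)
  have "\<forall>i\<in>{..<3}. \<exists>x. x \<in> P \<inter> b i \<and> (\<forall>y\<in>P \<inter> b i. dist 0 x \<le> dist 0 y) \<and> black b f x"
    using assms unfolding canonical_for_cycle_def by (simp add: Bex_def)
  then obtain \<beta> where \<beta>: "\<And>i. i < 3 \<Longrightarrow> \<beta> i \<in> P \<inter> b i \<and> (\<forall>y\<in>P \<inter> b i. dist 0 (\<beta> i) \<le> dist 0 y) \<and> black b f (\<beta> i)"
    using bchoice[of "{..<3}"] by (metis lessThan_iff)
  have 1: "\<beta> i \<in> P \<and> \<beta> i \<in> b i \<and> colour b f (\<beta> i) = 1" if "i < 3" for i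
    using \<beta>[OF that] by (simp add: black_iff)
  have 2: "norm (\<beta> i) \<le> norm y" if "i < 3" "y \<in> P" "sgn y = sgn (\<beta> i)" for i y
  proof -
    have "y \<in> b i" using numbering_sgn_eq_iff[OF b that(1), of "\<beta> i" y] 1[OF that(1)] that triod by auto
    then show ?thesis using \<beta>[OF that(1)] that(2) by auto
  qed
  have idx: "branch_index b u = i" if "i < 3" "u \<in> P" "u \<in> b i" for i u
  proof -
    have u: "u \<in> triod - {0}" using that(2) triod by blast
    have "b (branch_index b u) = b i"
      using numbering_sgn_eq_iff[OF b that(1,3)] branch_index_props[OF b u]
        numbering_sgn_eq_iff[OF b, of "branch_index b u" u] by blast
    then show ?thesis
      using b that(1) branch_index_props[OF b u] unfolding numbering_def bij_betw_def inj_on_def by auto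
  qed
  have step: "sgn (\<beta> j) = sgn (f (\<beta> i)) \<and> norm (\<beta> j) \<le> norm (f (\<beta> i))"
    if i: "i < 3" and j: "j = (i + 1) mod 3" for i j
  proof -
    have j3: "j < 3" using j by simp
    have fb: "f (\<beta> i) \<in> P" "f (\<beta> i) \<in> triod - {0}" using 1[OF i] map_mem triod by auto
    have "(int (branch_index b (f (\<beta> i))) - int i) mod 3 = 1"
      using 1[OF i] idx[OF i, of "\<beta> i"] by (simp add: colour_def)
    moreover have "branch_index b (f (\<beta> i)) < 3" using branch_index_props[OF b fb(2)] by simp
    ultimately have "branch_index b (f (\<beta> i)) = j" using i j by presburger
    then have "f (\<beta> i) \<in> b j" using branch_index_props[OF b fb(2)] by simp
    then have "sgn (f (\<beta> i)) = sgn (\<beta> j)"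
      using numbering_sgn_eq_iff[OF b j3, of "\<beta> j" "f (\<beta> i)"] 1[OF j3] by simp
    then show ?thesis using 2[OF j3 fb(1)] by simp
  qed
  have "wpath (\<beta> 0) [\<beta> 0, \<beta> 1, \<beta> 2] (\<beta> 0)"
    using step[of 0 1] step[of 1 2] step[of 2 0] 1 by simp
  then show ?thesis using that 1 2 by blast
qed

text \<open>The shortcut from \<open>(f ^^ m) x\<close> down to \<open>x\<close> gives a closed path
  of weight \<open>D\<close>, and a turn around the innermost points has weight
  \<open>3 * E\<close>. The sign hypothesis allows the two to be balanced by repetition.\<close>

lemma unfollowed_loop_exists:
  assumes canon: "canonical_for_cycle b f P" and \<rho>: "wind b \<noteq> int (card P)"
    and x: "x \<in> P" "0 < m" "m < card P" "sgn x = sgn ((f ^^ m) x)" "norm x \<le> norm ((f ^^ m) x)"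
    and D: "(\<Sum>j<m. weight b ((f ^^ j) x)) * (int (card P) - wind b) \<le> 0"
  shows "\<exists>M X. weak_loop M X \<and> (\<Sum>k<M. weight b (X k)) = 0 \<and>
    \<not> (\<exists>p\<in>P. (f ^^ M) p = p \<and> (\<forall>k<M. sgn ((f ^^ k) p) = sgn (X k)))"
proof -
  define n where "n = card P"
  define D where "D = (\<Sum>j<m. weight b ((f ^^ j) x))"
  define E where "E = int n - wind b"
  define A where "A = orbit_list x m"
  have b: "numbering b" using canon by (simp add: canonical_for_cycle_def)
  have lenA: "length A = m" by (simp add: A_def orbit_list_def)
  have A: "wpath x A x" unfolding A_def using wpath_orbit_drop x by blast
  have sumA: "(\<Sum>p\<leftarrow>A. weight b p) = D" by (simp add: A_def D_def sum_list_weight_orbit)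
  have E: "E \<noteq> 0" using \<rho> by (simp add: E_def n_def)
  show ?thesis
  proof (cases "D = 0")
    case True
    \<comment> \<open>The shortcut alone suffices: it closes up in fewer than \<open>card P\<close>
      steps, as no point of \<open>P\<close> does.\<close>
    have "(f ^^ m) p \<noteq> p" if "p \<in> P" for p
      using return_dvd[OF that, of m] dvd_imp_le[of "card P" m] x(2,3) by linarith
    then show ?thesis
      using weak_loop_of_wpath[OF A] sum_weight_list[of b A] sumA True lenA x(2)
      by (intro exI[of _ m] exI[of _ "\<lambda>k. A ! (k mod m)"]) auto
  next
    case False
    then have opp: "D * E < 0" using D E by (simp add: D_def E_def n_def order_less_le)
    \<comment> \<open>The repetition numbers cancel the two weights; the factor \<open>n\<close>
      makes \<open>e\<close> at least \<open>n\<close>, so that the black turns outlast a full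
      period of \<open>P\<close>.\<close>
    define a where "a = nat (3 * \<bar>E\<bar> * int n)"
    define e where "e = nat (\<bar>D\<bar> * int n)"
    have n0: "0 < n" using card_pos by (simp add: n_def)
    have ae: "int a * D + int e * (3 * E) = 0"
    proof -
      have "\<bar>E\<bar> * D + \<bar>D\<bar> * E = 0" using opp by (auto simp: abs_if mult_less_0_iff)
      then have "3 * int n * (\<bar>E\<bar> * D + \<bar>D\<bar> * E) = 0" by simp
      then show ?thesis by (simp add: a_def e_def algebra_simps)
    qed
    have en: "n \<le> e"
    proof -
      have "1 * int n \<le> \<bar>D\<bar> * int n" using False by (intro mult_right_mono) auto
      then show ?thesis by (simp add: e_def nat_le_iff le_nat_iff)
    qed
    obtain \<beta> where \<beta>: "\<And>i. i < 3 \<Longrightarrow> \<beta> i \<in> P \<and> \<beta> i \<in> b i \<and> colour b f (\<beta> i) = 1"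
      "wpath (\<beta> 0) [\<beta> 0, \<beta> 1, \<beta> 2] (\<beta> 0)"
      using innermost_loop[OF canon] by metis
    define B where "B = [\<beta> 0, \<beta> 1, \<beta> 2]"
    have \<beta>0: "\<beta> 0 \<in> P" using \<beta>(1) by simp
    obtain r where r: "\<beta> 0 = (f ^^ r) x" using reach[OF x(1) \<beta>0] by blast
    obtain s where s: "x = (f ^^ s) (\<beta> 0)" using reach[OF \<beta>0 x(1)] by blast
    \<comment> \<open>Copies of \<open>A\<close> and of the black loop \<open>B\<close>, whose weights have opposite signs, are balanced; the
      two orbit segments joining them have total weight \<open>0\<close>.\<close>
    define L where "L = concat (replicate a A) @ orbit_list x r"
    define xs where "xs = L @ concat (replicate e B) @ orbit_list (\<beta> 0) s"
    have "wpath x L (\<beta> 0)"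
      unfolding L_def using wpath_append[OF wpath_replicate[OF A]] wpath_orbit[OF x(1), of r] r by simp
    moreover have "wpath (\<beta> 0) (concat (replicate e B)) (\<beta> 0)"
      using wpath_replicate \<beta>(2) by (simp add: B_def)
    moreover have "wpath (\<beta> 0) (orbit_list (\<beta> 0) s) x" using wpath_orbit[OF \<beta>0, of s] s by simp
    ultimately have path: "wpath x xs x" unfolding xs_def using wpath_append by blast
    have ne: "xs \<noteq> []" using n0 en by (auto simp: xs_def B_def)
    have "(\<Sum>p\<leftarrow>orbit_list x r. weight b p) + (\<Sum>p\<leftarrow>orbit_list (\<beta> 0) s. weight b p) = 0"
    proof -
      have "(f ^^ (r + s)) x = x"
        using r s by (metis add.commute funpow_add o_apply)
      then have "(\<Sum>j<r + s. weight b ((f ^^ j) x)) = 0" by (rule sum_weight_return[OF x(1)])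
      moreover have "(f ^^ (r + j)) x = (f ^^ j) (\<beta> 0)" for j
        unfolding r by (metis add.commute funpow_add o_apply)
      ultimately show ?thesis by (simp add: sum_list_weight_orbit sum_lessThan_add)
    qed
    moreover have "(\<Sum>p\<leftarrow>B. weight b p) = 3 * E"
      using \<beta>(1)[of 0] \<beta>(1)[of 1] \<beta>(1)[of 2] by (simp add: B_def weight_def E_def n_def)
    ultimately have sum0: "(\<Sum>p\<leftarrow>xs. weight b p) = 0"
      using ae sumA by (simp add: xs_def L_def sum_list_weight_replicate)
    \<comment> \<open>A point of \<open>P\<close> following this loop would have \<open>n\<close> consecutive black iterates.\<close>
    have "\<not> (\<exists>p\<in>P. (f ^^ length xs) p = p \<and> (\<forall>k<length xs. sgn ((f ^^ k) p) = sgn (xs ! (k mod length xs))))"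
    proof
      assume "\<exists>p\<in>P. (f ^^ length xs) p = p \<and> (\<forall>k<length xs. sgn ((f ^^ k) p) = sgn (xs ! (k mod length xs)))"
      then obtain p where p: "p \<in> P" "\<And>k. k < length xs \<Longrightarrow> sgn ((f ^^ k) p) = sgn (xs ! k)" by auto
      define q where "q = (f ^^ length L) p"
      have q: "q \<in> P" using funpow_mem p(1) by (simp add: q_def)
      have sq: "sgn ((f ^^ j) q) = sgn (\<beta> (j mod 3))" if j: "j < 3 * e" for j
      proof -
        have "length L + j < length xs" using j by (simp add: xs_def length_concat_replicate B_def)
        then have "sgn ((f ^^ (length L + j)) p) = sgn (xs ! (length L + j))" by (rule p(2))
        moreover have "xs ! (length L + j) = B ! (j mod 3)"
          using j nth_concat_replicate[of j e B]
          by (simp add: xs_def nth_append length_concat_replicate B_def mult.commute)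
        moreover have "B ! (j mod 3) = \<beta> (j mod 3)"
        proof -
          have "j mod 3 = 0 \<or> j mod 3 = 1 \<or> j mod 3 = 2" by presburger
          then show ?thesis by (auto simp: B_def numeral_2_eq_2)
        qed
        moreover have "(f ^^ (length L + j)) p = (f ^^ j) q"
          unfolding q_def by (metis add.commute funpow_add o_apply)
        ultimately show ?thesis by simp
      qed
      have black_step: "sgn (f (\<beta> i)) = sgn (\<beta> ((i + 1) mod 3))" if "i < 3" for i
      proof -
        have "i = 0 \<or> i = 1 \<or> i = 2" using that by linarith
        then show ?thesis using \<beta>(2) by (auto simp: numeral_2_eq_2 dest: sym)
      qed
      have "colour b f ((f ^^ j) q) = 1" if j: "j < n" for j
      proof -
        have "j < 3 * e" "Suc j < 3 * e" using j en n0 by linarith+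
        then have "sgn ((f ^^ j) q) = sgn (\<beta> (j mod 3))" "sgn (f ((f ^^ j) q)) = sgn (f (\<beta> (j mod 3)))"
          using sq[of j] sq[of "Suc j"] black_step[of "j mod 3"] by (simp_all add: mod_Suc_eq)
        moreover have "\<beta> (j mod 3) \<in> P" "f (\<beta> (j mod 3)) \<in> P" "(f ^^ j) q \<in> P" "f ((f ^^ j) q) \<in> P"
          using \<beta>(1)[of "j mod 3"] map_mem funpow_mem[OF q] by auto
        ultimately have "colour b f ((f ^^ j) q) = colour b f (\<beta> (j mod 3))"
          using triod by (intro colour_cong[OF b]) auto
        then show ?thesis using \<beta>(1)[of "j mod 3"] by simp
      qed
      then have "wind b = int n" using sum_colour_period[OF q, of b] by (simp add: n_def)
      then show False using E by (simp add: E_def)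
    qed
    then show ?thesis
      using weak_loop_of_wpath[OF path ne] sum_weight_list[of b xs] sum0 by metis
  qed
qed

text \<open>Tightening keeps the branches, hence colours and weights. The result cannot consist of
  innermost points only: these are black and would give the total weight
  \<open>M * (card P - wind b)\<close>, which is not \<open>0\<close>.\<close>

lemma tight_loop_exists:
  assumes canon: "canonical_for_cycle b f P" and \<rho>: "wind b \<noteq> int (card P)"
    and X: "weak_loop M X" "(\<Sum>k<M. weight b (X k)) = 0"
      "\<not> (\<exists>p\<in>P. (f ^^ M) p = p \<and> (\<forall>k<M. sgn ((f ^^ k) p) = sgn (X k)))"
  shows "\<exists>Y. tight_loop M Y \<and> (\<Sum>k<M. weight b (Y k)) = 0"
proof -
  obtain Y where Y: "weak_loop M Y" "tight Y" "\<And>k. sgn (Y k) = sgn (X k)"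
    using weak_loop_minimal[OF X(1)] by blast
  have b: "numbering b" using canon by (simp add: canonical_for_cycle_def)
  have M: "0 < M" using X(1) by (simp add: weak_loop_def)
  have YP: "Y k \<in> P" "X k \<in> P" "sgn (f (Y k)) = sgn (f (X k))" for k
    using X(1) Y(1) Y(3)[of "Suc k"] by (auto simp: weak_loop_def)
  have "colour b f (Y k) = colour b f (X k)" for k
    using YP[of k] map_mem[of "X k"] map_mem[of "Y k"] triod Y(3)[of k] by (intro colour_cong[OF b]) auto
  then have s0: "(\<Sum>k<M. weight b (Y k)) = 0" using X(2) by (simp add: weight_def)
  have "\<exists>k. \<exists>y\<in>P. sgn y = sgn (Y k) \<and> norm y < norm (Y k)"
  proof (rule ccontr)
    assume c: "\<not> ?thesis"
    obtain \<beta> where \<beta>: "\<And>i. i < 3 \<Longrightarrow> \<beta> i \<in> P \<and> \<beta> i \<in> b i \<and> colour b f (\<beta> i) = 1"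
      "\<And>i y. \<lbrakk>i < 3; y \<in> P; sgn y = sgn (\<beta> i)\<rbrakk> \<Longrightarrow> norm (\<beta> i) \<le> norm y"
      using innermost_loop[OF canon] by metis
    have "colour b f (Y k) = 1" for k
    proof -
      define i where "i = branch_index b (Y k)"
      have i: "i < 3" "Y k \<in> b i" using branch_index_props[OF b, of "Y k"] YP(1)[of k] triod by (auto simp: i_def)
      have s: "sgn (Y k) = sgn (\<beta> i)"
        using numbering_sgn_eq_iff[OF b i(1), of "\<beta> i" "Y k"] \<beta>(1)[OF i(1)] i(2) by simp
      have "norm (\<beta> i) \<le> norm (Y k)" using \<beta>(2)[OF i(1) YP(1) s] .
      moreover have "\<not> norm (\<beta> i) < norm (Y k)" using c \<beta>(1)[OF i(1)] s by metis
      ultimately have "norm (Y k) = norm (\<beta> i)" by linarith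
      with s have "Y k = \<beta> i" by (rule sgn_norm_eqI)
      then show ?thesis using \<beta>(1)[OF i(1)] by simp
    qed
    then have "(\<Sum>k<M. weight b (Y k)) = int M * (int (card P) - wind b)" by (simp add: weight_def)
    then show False using s0 \<rho> M by simp
  qed
  moreover have "\<forall>k. Y (k + M) = Y k" using Y(1) by (simp add: weak_loop_def)
  ultimately have "tight_loop M Y" using M Y(2,3) X(3) by (simp add: tight_loop_def)
  then show ?thesis using s0 by blast
qed

end

section \<open>The characterization of triod twists\<close>

context cycle
begin

text \<open>The sign \<open>\<sigma>\<close> merges the two cases of the definition of monotone code functions.\<close>

lemma code_strictly_increasing_iff:
  assumes \<rho>: "rotation_number b f P \<noteq> 1 / 3"
    and \<sigma>: "\<sigma> = (if rotation_number b f P < 1 / 3 then - 1 else 1)"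
  shows "code_strictly_increasing b f P \<psi> \<longleftrightarrow>
    (\<forall>x\<in>P. \<forall>y\<in>P. sgn x = sgn y \<and> norm x < norm y \<longrightarrow> \<sigma> * \<psi> x < \<sigma> * \<psi> y)" (is "_ \<longleftrightarrow> ?R")
proof
  assume s: "code_strictly_increasing b f P \<psi>"
  have le: "\<sigma> * \<psi> y \<le> \<sigma> * \<psi> x" if "x \<in> P" "y \<in> P" "farther x y" for x y
    using s \<rho> that unfolding code_strictly_increasing_def code_nondecreasing_def \<sigma>
    by (cases "rotation_number b f P < 1 / 3") auto
  have ne: "\<psi> x \<noteq> \<psi> y" if "consecutive P x y" for x y
    using s that unfolding code_strictly_increasing_def by blast
  show ?R
  proof (intro ballI impI)
    fix y x assume yx: "y \<in> P" "x \<in> P" "sgn y = sgn x \<and> norm y < norm x"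
    \<comment> \<open>The outermost element \<open>z\<close> of \<open>S\<close> is the inner
      neighbour of \<open>x\<close>: strictness holds for this consecutive pair, and monotonicity
      covers the rest of the way down to \<open>y\<close>.\<close>
    define S where "S = {z \<in> P. sgn z = sgn x \<and> norm z < norm x}"
    have S: "finite S" "y \<in> S" using finite yx by (auto simp: S_def)
    obtain z where z: "z \<in> S" "\<And>u. u \<in> S \<Longrightarrow> norm u \<le> norm z"
    proof -
      have "Max (norm ` S) \<in> norm ` S" using S by (intro Max_in) auto
      then obtain z where "z \<in> S" "norm z = Max (norm ` S)" by auto
      then show ?thesis using that[of z] S by simp
    qed
    have T: "x \<in> triod - {0}" "z \<in> triod - {0}" "y \<in> triod - {0}" using triod z(1) yx by (auto simp: S_def)
    have xz: "farther x z" using z(1) T by (auto simp: farther_iff S_def)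
    have "\<not> (\<exists>u\<in>P. farther x u \<and> farther u z)"
      using z(2) by (force simp: farther_iff S_def)
    then have "consecutive P x z" using xz yx z(1) by (auto simp: consecutive_def S_def)
    then have "\<sigma> * \<psi> z < \<sigma> * \<psi> x"
      using ne le[OF yx(2) _ xz] z(1) \<sigma> by (force simp: S_def order_less_le)
    moreover have "\<sigma> * \<psi> y \<le> \<sigma> * \<psi> z"
    proof (cases "norm y = norm z")
      case True
      moreover have "sgn y = sgn z" using z(1) yx by (simp add: S_def)
      ultimately have "y = z" using sgn_norm_eqI by blast
      then show ?thesis by simp
    next
      case False
      then have "farther z y" using z(1) z(2)[OF S(2)] yx T by (auto simp: farther_iff S_def)
      then show ?thesis using le[of z y] z(1) yx by (auto simp: S_def)
    qed
    ultimately show "\<sigma> * \<psi> y < \<sigma> * \<psi> x" by linarith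
  qed
next
  assume R: ?R
  have less: "\<sigma> * \<psi> y < \<sigma> * \<psi> x" if "x \<in> P" "y \<in> P" "farther x y" for x y
    using R that by (auto simp: farther_iff)
  show "code_strictly_increasing b f P \<psi>"
    unfolding code_strictly_increasing_def code_nondecreasing_def
  proof (intro conjI impI ballI allI)
    fix x y assume "rotation_number b f P < 1 / 3" "x \<in> P" "y \<in> P" "farther x y"
    then show "\<psi> x \<le> \<psi> y" using less[of x y] \<sigma> by simp
  next
    fix x y assume "rotation_number b f P > 1 / 3" "x \<in> P" "y \<in> P" "farther x y"
    then show "\<psi> x \<ge> \<psi> y" using less[of x y] \<sigma> by simp
  next
    fix x y assume "consecutive P x y"
    then show "\<psi> x \<noteq> \<psi> y" using less[of x y] by (auto simp: consecutive_def)
  qed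
qed

text \<open>The potential changes by a negative multiple of \<open>D\<close>, and a rotation number
  below \<open>1/3\<close> means \<open>wind b < card P\<close>. In both cases the violation gives
  \<open>D * (card P - wind b) \<le> 0\<close>, the balancing condition for loops.\<close>

lemma forces_of_nonstrict_potential:
  assumes canon: "canonical_for_cycle b f P" and \<rho>: "rotation_number b f P \<noteq> 1 / 3"
    and \<sigma>: "\<sigma> = (if rotation_number b f P < 1 / 3 then - 1 else 1)" and pot: "potential b \<Psi>"
    and xy: "x \<in> P" "y \<in> P" "sgn x = sgn y" "norm x < norm y" "\<not> \<sigma> * \<Psi> x < \<sigma> * \<Psi> y"
  shows "\<exists>B\<in>patterns. B \<noteq> pattern_of f P \<and> forces (pattern_of f P) B \<and>
    pattern_rotation_number b B = rotation_number b f P"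
proof -
  have b: "numbering b" using canon by (simp add: canonical_for_cycle_def)
  have n: "0 < real (card P)" using card_pos by simp
  obtain m where m: "m < card P" "y = (f ^^ m) x" using reach[OF xy(1,2)] by blast
  have m0: "0 < m" using m(2) xy(4) by (cases m) auto
  define D where "D = (\<Sum>j<m. weight b ((f ^^ j) x))"
  have \<Psi>: "\<Psi> y - \<Psi> x = - of_int D / (3 * real (card P))"
    using potential_weight[OF pot xy(1), of m] by (simp add: m(2) D_def)
  have neq: "wind b \<noteq> int (card P)"
    using \<rho> n by (auto simp: rotation_number_eq)
  have lt: "rotation_number b f P < 1 / 3 \<longleftrightarrow> wind b < int (card P)"
  proof -
    have "rotation_number b f P < 1 / 3 \<longleftrightarrow> real_of_int (wind b) < real_of_int (int (card P))"
      using n by (simp add: rotation_number_eq divide_simps)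
    then show ?thesis by (simp only: of_int_less_iff)
  qed
  have "D * (int (card P) - wind b) \<le> 0"
  proof (cases "wind b < int (card P)")
    case True
    then have "0 \<le> \<Psi> y - \<Psi> x" using xy(5) \<sigma> lt by simp
    then have "D \<le> 0" unfolding \<Psi> using n by (auto simp: divide_le_0_iff)
    then show ?thesis using True by (simp add: mult_nonpos_nonneg)
  next
    case False
    then have "\<Psi> y - \<Psi> x \<le> 0" using xy(5) \<sigma> lt by simp
    then have "0 \<le> D" unfolding \<Psi> using n by (auto simp: zero_le_divide_iff)
    then show ?thesis using False by (simp add: mult_nonneg_nonpos)
  qed
  then obtain M X where X: "weak_loop M X" "(\<Sum>k<M. weight b (X k)) = 0"
    "\<not> (\<exists>p\<in>P. (f ^^ M) p = p \<and> (\<forall>k<M. sgn ((f ^^ k) p) = sgn (X k)))"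
    using unfollowed_loop_exists[OF canon neq xy(1) m0 m(1)] xy(3,4) m(2) unfolding D_def by auto
  then obtain Y where "tight_loop M Y" "(\<Sum>k<M. weight b (Y k)) = 0"
    using tight_loop_exists[OF canon neq X] by blast
  then show ?thesis by (rule forces_shadow_pattern[OF _ b])
qed

end

theorem theorem3p16:
  fixes \<pi> :: pattern and b :: "nat \<Rightarrow> complex set"
  assumes "\<pi> \<in> patterns"
    and "regular_pattern \<pi>"
    and "canonical_for_pattern b \<pi>"
    and "pattern_rotation_number b \<pi> \<noteq> 1 / 3"
  shows "triod_twist b \<pi> \<longleftrightarrow> green_pattern \<pi> \<and> has_strictly_increasing_code b \<pi>"
proof -
  obtain f0 P0 where \<pi>0: "(f0, P0) \<in> \<pi>"
    using assms(1) equiv_Eps_in[OF equiv_cycle_equiv] unfolding patterns_def by (metis prod.collapse)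
  have fact: "cycle f P \<and> canonical_for_cycle b f P \<and> \<pi> = pattern_of f P \<and>
      rotation_number b f P = pattern_rotation_number b \<pi>" if "(f, P) \<in> \<pi>" for f P
  proof -
    have canon: "canonical_for_cycle b f P" using assms(3) that by (auto simp: canonical_for_pattern_def)
    then have "numbering b" by (simp add: canonical_for_cycle_def)
    then show ?thesis
      using canon pattern_eq_pattern_of[OF assms(1) that] pattern_rotation_number_eq[OF assms(1) that]
      by (simp add: cycle_def)
  qed
  have b: "numbering b" using fact[OF \<pi>0] by (simp add: canonical_for_cycle_def)
  have idx: "branch_index b x = branch_index b y" if "cycle f P" "x \<in> P" "y \<in> P" "sgn x = sgn y" for f P x y
    using branch_index_eq_iff[OF b] cycle.triod[OF that(1)] that(2-) by blast
  define \<sigma> :: real where "\<sigma> = (if pattern_rotation_number b \<pi> < 1 / 3 then - 1 else 1)"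
  show ?thesis
  proof
    assume tw: "triod_twist b \<pi>"
    \<comment> \<open>A violation would produce another forced pattern with the same rotation
      number, which a twist does not have.\<close>
    have strict: "\<sigma> * \<Psi> x < \<sigma> * \<Psi> y"
      if "(f, P) \<in> \<pi>" "cycle.potential f P b \<Psi>" "x \<in> P" "y \<in> P" "sgn x = sgn y" "norm x < norm y"
      for f P \<Psi> x y
    proof (rule ccontr)
      assume "\<not> ?thesis"
      then have "\<exists>B\<in>patterns. B \<noteq> \<pi> \<and> forces \<pi> B \<and> pattern_rotation_number b B = pattern_rotation_number b \<pi>"
        using cycle.forces_of_nonstrict_potential[of f P b \<sigma> \<Psi> x y] fact[OF that(1)] that assms(4)
        by (simp add: \<sigma>_def)
      then show False using tw by (auto simp: triod_twist_def)
    qed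
    show "green_pattern \<pi> \<and> has_strictly_increasing_code b \<pi>"
    proof
      show "green_pattern \<pi>"
        unfolding green_pattern_def
      proof clarify
        fix f P assume fP: "(f, P) \<in> \<pi>"
        then interpret cycle f P using fact by blast
        obtain \<Psi> where pot: "potential b \<Psi>" using potential_exists by blast
        show "green_cycle f P"
          unfolding green_cycle_def
        proof (intro conjI ballI impI)
          show "regular_cycle f P" using fact[OF fP] assms(2) by (simp add: regular_cycle_def)
          fix x y assume xy: "x \<in> P" "y \<in> P" and "farther x y \<and> same_branch (f x) (f y)"
          then have s: "sgn x = sgn y" "norm y < norm x" "sgn (f x) = sgn (f y)"
            by (auto simp: farther_iff same_branch_iff)
          have fxy: "f x \<in> P" "f y \<in> P" using xy map_mem by auto
          have T: "x \<in> triod - {0}" "y \<in> triod - {0}" "f x \<in> triod - {0}" "f y \<in> triod - {0}"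
            using xy fxy triod by auto
          \<comment> \<open>Points of one branch with images on one branch have the same colour, so
            \<open>f\<close> preserves their difference of potential and, by strictness, their
            order.\<close>
          have "colour b f x = colour b f y" using T s by (intro colour_cong[OF b])
          then have "\<Psi> (f x) - \<Psi> (f y) = \<Psi> x - \<Psi> y" using pot xy by (simp add: potential_def)
          then have "\<sigma> * \<Psi> (f x) - \<sigma> * \<Psi> (f y) = \<sigma> * \<Psi> x - \<sigma> * \<Psi> y"
            by (metis right_diff_distrib)
          moreover have "\<sigma> * \<Psi> y < \<sigma> * \<Psi> x" using strict[OF fP pot xy(2,1)] s by simp
          ultimately have "\<not> norm (f x) < norm (f y)" using strict[OF fP pot fxy s(3)] by linarith
          moreover have "norm (f x) \<noteq> norm (f y)"
          proof
            assume "norm (f x) = norm (f y)"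
            with s(3) have "f x = f y" by (rule sgn_norm_eqI)
            then have "x = y" using inj xy by (auto dest: inj_onD)
            then show False using s(2) by simp
          qed
          ultimately show "farther (f x) (f y)" using T s(3) by (simp add: farther_iff)
        qed
      qed
      show "has_strictly_increasing_code b \<pi>"
        unfolding has_strictly_increasing_code_def
      proof clarify
        fix f P assume fP: "(f, P) \<in> \<pi>"
        then interpret cycle f P using fact by blast
        obtain \<Psi> where pot: "potential b \<Psi>" using potential_exists by blast
        obtain x0 where x0: "x0 \<in> P" using nonempty by blast
        define \<psi> where
          "\<psi> x = \<Psi> x - \<Psi> x0 + of_int ((int (branch_index b x) - int (branch_index b x0)) mod 3) / 3" for x
        have "code_function b f P \<psi>"
          using code_function_of_potential[OF pot x0] by (simp add: \<psi>_def[abs_def])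
        \<comment> \<open>On each branch \<open>\<psi>\<close> and \<open>\<Psi>\<close> differ by a
          constant, so strictness carries over.\<close>
        moreover have "code_strictly_increasing b f P \<psi>"
        proof (subst code_strictly_increasing_iff[where \<sigma> = \<sigma>], goal_cases)
          case 3
          show ?case
          proof (intro ballI impI)
            fix x y assume xy: "x \<in> P" "y \<in> P" "sgn x = sgn y \<and> norm x < norm y"
            have "\<psi> x - \<psi> y = \<Psi> x - \<Psi> y" using idx[OF cycle_axioms, of x y] xy by (simp add: \<psi>_def)
            then have "\<sigma> * \<psi> x - \<sigma> * \<psi> y = \<sigma> * \<Psi> x - \<sigma> * \<Psi> y" by (metis right_diff_distrib)
            then show "\<sigma> * \<psi> x < \<sigma> * \<psi> y" using strict[OF fP pot xy(1,2)] xy(3) by linarith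
          qed
        qed (use fact[OF fP] assms(4) in \<open>simp_all add: \<sigma>_def\<close>)
        ultimately show "\<exists>\<psi>. code_function b f P \<psi> \<and> code_strictly_increasing b f P \<psi>" by blast
      qed
    qed
  next
    assume "green_pattern \<pi> \<and> has_strictly_increasing_code b \<pi>"
    then obtain \<psi> where \<psi>: "code_function b f0 P0 \<psi>" "code_strictly_increasing b f0 P0 \<psi>"
      using \<pi>0 unfolding has_strictly_increasing_code_def by blast
    interpret cycle f0 P0 using fact[OF \<pi>0] by blast
    have \<rho>: "rotation_number b f0 P0 = pattern_rotation_number b \<pi>" and \<pi>: "\<pi> = pattern_of f0 P0"
      using fact[OF \<pi>0] by auto
    obtain x0 where pot: "potential b
        (\<lambda>x. \<psi> x - of_int ((int (branch_index b x) - int (branch_index b x0)) mod 3) / 3)"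
      using potential_of_code_function[OF \<psi>(1)] .
    have strict: "\<sigma> * \<psi> x < \<sigma> * \<psi> y" if "x \<in> P0" "y \<in> P0" "sgn x = sgn y" "norm x < norm y" for x y
      using \<psi>(2) that code_strictly_increasing_iff[of b \<sigma> \<psi>] \<rho> assms(4) by (simp add: \<sigma>_def)
    \<comment> \<open>The branch corrections cancel on each branch, so the potential is as strict as
      \<open>\<psi>\<close> and the rigid map is available.\<close>
    obtain F where F: "F \<in> triod_maps" "\<forall>p\<in>P0. F p = f0 p"
      "\<And>Q. (F, Q) \<in> cycles \<Longrightarrow> rotation_number b F Q = rotation_number b f0 P0 \<Longrightarrow> Q = P0"
    proof -
      have "\<exists>F\<in>triod_maps. (\<forall>p\<in>P0. F p = f0 p) \<and>
          (\<forall>Q. (F, Q) \<in> cycles \<and> rotation_number b F Q = rotation_number b f0 P0 \<longrightarrow> Q = P0)"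
      proof (rule rigid_map_exists[OF b pot, where \<sigma> = \<sigma>])
        fix x y assume xy: "x \<in> P0" "y \<in> P0" "sgn x = sgn y" "norm x < norm y"
        then show "\<sigma> * (\<psi> x - of_int ((int (branch_index b x) - int (branch_index b x0)) mod 3) / 3)
            < \<sigma> * (\<psi> y - of_int ((int (branch_index b y) - int (branch_index b x0)) mod 3) / 3)"
          using strict[OF xy] idx[OF cycle_axioms xy(1-3)] by (simp add: right_diff_distrib)
      qed
      then show ?thesis using that by blast
    qed
    have Fk: "(F ^^ k) x = (f0 ^^ k) x" if "x \<in> P0" for x k
    proof (induction k)
      case (Suc k)
      then show ?case using F(2) funpow_mem[OF that, of k] by simp
    qed simp
    have "(F, P0) \<in> cycles"
    proof -
      obtain x n where x: "x \<in> triod" "0 < n" "(f0 ^^ n) x = x" "P0 = range (\<lambda>k. (f0 ^^ k) x)" "P0 \<noteq> {0}"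
        using mem_cycles by (auto simp: cycles_def periodic_orbit_def)
      have xP: "x \<in> P0" unfolding x(4) by (auto intro!: image_eqI[of _ _ 0])
      have "range (\<lambda>k. (F ^^ k) x) = P0" "(F ^^ n) x = x" unfolding x(4) using Fk[OF xP] x(3) by auto
      then show ?thesis using F(1) x(1,2,5) by (auto simp: cycles_def periodic_orbit_def)
    qed
    moreover have "conjugation f0 P0 F P0 id" using F(2) by (simp add: conjugation_def)
    ultimately have F\<pi>: "(F, P0) \<in> \<pi>" unfolding \<pi> mem_pattern_of_iff using mem_cycles by blast
    \<comment> \<open>Forcing is tested on the single map \<open>F\<close>: it must exhibit
      \<open>B\<close>, and its only cycle with the right rotation number is
      \<open>P0\<close>.\<close>
    have "B = \<pi>" if B: "B \<in> patterns" "forces \<pi> B" "pattern_rotation_number b B = pattern_rotation_number b \<pi>" for B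
    proof -
      obtain Q where Q: "(F, Q) \<in> B" using B(2) F(1) F\<pi> unfolding forces_def by blast
      have "(F, Q) \<in> cycles" "B = pattern_of F Q" using pattern_eq_pattern_of[OF B(1) Q] by auto
      moreover have "rotation_number b F Q = rotation_number b f0 P0"
        using pattern_rotation_number_eq[OF B(1) Q b] B(3) \<rho> by simp
      ultimately have "B = pattern_of F P0" using F(3) by blast
      also have "\<dots> = \<pi>" using pattern_eq_pattern_of[OF assms(1) F\<pi>] by simp
      finally show ?thesis .
    qed
    then show "triod_twist b \<pi>" using assms(1,2) unfolding triod_twist_def by blast
  qed
qed

end
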